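(* (Global existence and uniqueness.) Let $\alpha\in(\frac13,\frac12]$, $T>0$, let $V,W,U$ be Banach spaces, let $\mathbf X=(1,X,\mathbb X)\in\mathcal D^\alpha(\Delta_T,V)$, $\mathbf Z=(Z,Z')\in\mathcal C^\alpha_{\mathbf X}([0,T],U)$, $F\in C^3_b(W,\mathcal L(U,W))$, and let an initial value $Y_0\in W$ be given. Then there exists a unique controlled solution $\mathbf Y=(Y,Y')\in\mathcal C^\alpha_{\mathbf X}([0,T],W)$ with initial value $Y_0$ of $$Y_t=Y_0+\int_0^tF(Y_r)\,d\mathbf Z_r,\qquad t\in[0,T],$$ that is, a unique $\mathbf Y=(Y,Y')\in\mathcal C^\alpha_{\mathbf X}([0,T],W)$ such that $(Y_t,Y'_t)=\big(Y_0+\int_0^tF(Y_r)\,d\mathbf Z_r,\;F(Y_t)Z'_t\big)$ for all $t\in[0,T]$.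
   Context: All Banach spaces are real; tensor products of Banach spaces carry a fixed admissible cross norm and are completed (for definiteness one may take the projective tensor norm throughout). $\mathcal L(A,B)$ is the space of bounded linear maps. For a path $X$, $X_{s,t}:=X_t-X_s$. $\Delta_T:=\{(s,t):0\le s\le t\le T\}$. $C^m_b(A,B)$ is the space of $m$ times continuously differentiable maps $F:A\to B$ with $\|F\|_\infty+\|DF\|_\infty+\dots+\|D^mF\|_\infty<\infty$. Rough path: for $\alpha\in(\frac13,\frac12]$, $\mathbf X=(1,X,\mathbb X):\Delta_T\to\mathbb R\oplus V\oplus V^{\otimes2}$ belongs to $\mathcal D^\alpha(\Delta_T,V)$ if Chen's relation holds, i.e. $X_{s,t}=X_{s,u}+X_{u,t}$ and $\mathbb X_{s,t}=\mathbb X_{s,u}+\mathbb X_{u,t}+X_{s,u}\otimes X_{u,t}$ for $s\le u\le t$, and $\sup_{s\ne t}\frac{|X_{s,t}|}{|t-s|^\alpha}<\infty$, $\sup_{s\neq t}\frac{|\mathbb X_{s,t}|}{|t-s|^{2\alpha}}<\infty$. Controlled rough path: for a Banach space $E$, $\mathcal C^\alpha_{\mathbf X}([0,T],E)$ is the set of $\mathbf Y=(Y,Y'):[0,T]\to E\times\mathcal L(V,E)$ such that, with $R^{0,\mathbf Y}_{s,t}:=Y_{s,t}-Y'_sX_{s,t}$ and $R^{1,\mathbf Y}_{s,t}:=Y'_t-Y'_s$, one has $\sup_{s\ne t}\frac{|R^{0,\mathbf Y}_{s,t}|}{|t-s|^{2\alpha}}<\infty$ and $\sup_{s\ne t}\frac{|R^{1,\mathbf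 Y}_{s,t}|}{|t-s|^{\alpha}}<\infty$. Rough integral: for $\mathbf G=(G,G')\in\mathcal C^\alpha_{\mathbf X}([0,T],\mathcal L(U,W))$ and $\mathbf Z\in\mathcal C^\alpha_{\mathbf X}([0,T],U)$, $\int_s^tG_r\,d\mathbf Z_r:=\lim_{|\pi|\to0}\sum_{[u,v]\in\pi}\big(G_uZ_{u,v}+G'_uZ'_u\mathbb X_{u,v}\big)\in W$, over partitions $\pi$ of $[s,t]$ (this limit is known to exist), where $G'_uZ'_u$ acts on $V\otimes V$ as the linear extension of $x_1\otimes x_2\mapsto[G'_u(x_1)](Z'_u(x_2))$. The integrand $F(Y)$ is understood as the $\mathbf X$-controlled rough path $F(\mathbf Y):=(F(Y),DF(Y)Y')$. *)

theory Defs
  imports "HOL-Analysis.Analysis"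
begin

section \<open>The completed projective tensor product\<close>

text \<open>
  \<open>projective_tensor t\<close> says that the Banach space \<open>'c\<close>, with \<open>t x y\<close> in the role of
  \<open>x \<otimes> y\<close>, is the completed projective tensor product of \<open>'a\<close> and \<open>'b\<close>; this determines it up to
  isometric isomorphism. A list \<open>ps\<close> of pairs stands for the algebraic tensor \<open>\<Sum> x\<^sub>i \<otimes> y\<^sub>i\<close>
  (scalars can be absorbed into the \<open>x\<^sub>i\<close>). The second clause says that the algebraic tensor
  product embeds into \<open>'c\<close>: an element \<open>\<Sum> x\<^sub>i \<otimes> y\<^sub>i\<close> of it is zero iff all (not
  necessarily bounded) bilinear forms annihilate it. The third clause is the usual formula for the
  projective norm, and the last one says that \<open>'c\<close> is the completion.
\<close>

definition tensor_sum :: "('a \<Rightarrow> 'b \<Rightarrow> 'c::comm_monoid_add) \<Rightarrow> ('a \<times> 'b) list \<Rightarrow> 'c" where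
  "tensor_sum t ps = (\<Sum>(x, y)\<leftarrow>ps. t x y)"

definition projective_tensor ::
  "('a::real_normed_vector \<Rightarrow> 'b::real_normed_vector \<Rightarrow> 'c::banach) \<Rightarrow> bool" where
  "projective_tensor t \<longleftrightarrow>
     bilinear t \<and>
     (\<forall>ps. tensor_sum t ps = 0 \<longrightarrow>
        (\<forall>b :: 'a \<Rightarrow> 'b \<Rightarrow> real. bilinear b \<longrightarrow> tensor_sum b ps = 0)) \<and>
     (\<forall>ps. norm (tensor_sum t ps) =
        Inf {(\<Sum>(x, y)\<leftarrow>qs. norm x * norm y) | qs. tensor_sum t qs = tensor_sum t ps}) \<and>
     closure (range (tensor_sum t)) = UNIV"

text \<open>
  The bounded linear extension to the tensor product of the map \<open>x \<otimes> y \<mapsto> b x y\<close>, for bounded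
  bilinear \<open>b\<close>. It exists and is unique if \<open>projective_tensor t\<close>.
\<close>

definition tensor_extension ::
  "('a \<Rightarrow> 'b \<Rightarrow> 'c::real_normed_vector) \<Rightarrow> ('a \<Rightarrow> 'b \<Rightarrow> 'd::real_normed_vector) \<Rightarrow> 'c \<Rightarrow>\<^sub>L 'd" where
  "tensor_extension t b = (THE L. \<forall>x y. blinfun_apply L (t x y) = b x y)"


section \<open>Rough paths and controlled rough paths\<close>

text \<open>Two-parameter functions on \<open>{(s, t). 0 \<le> s \<le> t \<le> T}\<close> are represented by
  functions on \<open>real\<close>, whose values outside this set are irrelevant.\<close>

definition holder_bounded ::
  "real \<Rightarrow> real \<Rightarrow> (real \<Rightarrow> real \<Rightarrow> 'a::real_normed_vector) \<Rightarrow> bool" where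
  "holder_bounded \<beta> T A \<longleftrightarrow>
     bdd_above {norm (A s t) / \<bar>t - s\<bar> powr \<beta> | s t. 0 \<le> s \<and> s < t \<and> t \<le> T}"

text \<open>The constant component \<open>1\<close> of a rough path \<open>(1, X, XX)\<close> is left implicit.\<close>

definition rough_path ::
  "('v::real_normed_vector \<Rightarrow> 'v \<Rightarrow> 'vv::real_normed_vector) \<Rightarrow> real \<Rightarrow> real \<Rightarrow>
     (real \<Rightarrow> real \<Rightarrow> 'v) \<Rightarrow> (real \<Rightarrow> real \<Rightarrow> 'vv) \<Rightarrow> bool" where
  "rough_path tens \<alpha> T X XX \<longleftrightarrow>
     (\<forall>s u t. 0 \<le> s \<and> s \<le> u \<and> u \<le> t \<and> t \<le> T \<longrightarrow>
        X s t = X s u + X u t \<and>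
        XX s t = XX s u + XX u t + tens (X s u) (X u t)) \<and>
     holder_bounded \<alpha> T X \<and>
     holder_bounded (2 * \<alpha>) T XX"

definition controlled_path ::
  "real \<Rightarrow> real \<Rightarrow> (real \<Rightarrow> real \<Rightarrow> 'v::real_normed_vector) \<Rightarrow>
     (real \<Rightarrow> 'e::real_normed_vector) \<Rightarrow> (real \<Rightarrow> 'v \<Rightarrow>\<^sub>L 'e) \<Rightarrow> bool" where
  "controlled_path \<alpha> T X Y Y' \<longleftrightarrow>
     holder_bounded (2 * \<alpha>) T (\<lambda>s t. Y t - Y s - blinfun_apply (Y' s) (X s t)) \<and>
     holder_bounded \<alpha> T (\<lambda>s t. Y' t - Y' s)"


section \<open>The rough integral\<close>

text \<open>A partition \<open>s = p\<^sub>0 < \<dots> < p\<^sub>n = t\<close> is the list of its points, and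
  \<open>partition_intervals\<close> lists the pairs \<open>(p\<^sub>i, p\<^sub>i\<^sub>+\<^sub>1)\<close>.\<close>

definition is_partition :: "real \<Rightarrow> real \<Rightarrow> real list \<Rightarrow> bool" where
  "is_partition s t ps \<longleftrightarrow> ps \<noteq> [] \<and> hd ps = s \<and> last ps = t \<and> sorted_wrt (<) ps"

definition partition_intervals :: "real list \<Rightarrow> (real \<times> real) list" where
  "partition_intervals ps = zip ps (tl ps)"

text \<open>The filter of partitions of \<open>[s, t]\<close> with mesh size tending to zero.\<close>

definition partition_filter :: "real \<Rightarrow> real \<Rightarrow> real list filter" where
  "partition_filter s t =
     (INF \<delta>\<in>{0<..}. principal
        {ps. is_partition s t ps \<and> (\<forall>(u, v)\<in>set (partition_intervals ps). v - u < \<delta>)})"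

text \<open>In the following, \<open>(G, G')\<close> and \<open>(Z, Z')\<close> are controlled by \<open>X\<close>.\<close>

definition rough_sum ::
  "('v::real_normed_vector \<Rightarrow> 'v \<Rightarrow> 'vv::real_normed_vector) \<Rightarrow> (real \<Rightarrow> real \<Rightarrow> 'vv) \<Rightarrow>
     (real \<Rightarrow> 'u \<Rightarrow>\<^sub>L 'w) \<Rightarrow> (real \<Rightarrow> 'v \<Rightarrow>\<^sub>L ('u \<Rightarrow>\<^sub>L 'w)) \<Rightarrow>
     (real \<Rightarrow> 'u::real_normed_vector) \<Rightarrow> (real \<Rightarrow> 'v \<Rightarrow>\<^sub>L 'u) \<Rightarrow> real list \<Rightarrow>
     'w::real_normed_vector" where
  "rough_sum tens XX G G' Z Z' ps =
     (\<Sum>(u, v)\<leftarrow>partition_intervals ps.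
        blinfun_apply (G u) (Z v - Z u) +
        blinfun_apply
          (tensor_extension tens
             (\<lambda>x y. blinfun_apply (blinfun_apply (G' u) x) (blinfun_apply (Z' u) y)))
          (XX u v))"

definition rough_integral ::
  "('v::real_normed_vector \<Rightarrow> 'v \<Rightarrow> 'vv::real_normed_vector) \<Rightarrow> (real \<Rightarrow> real \<Rightarrow> 'vv) \<Rightarrow>
     (real \<Rightarrow> 'u \<Rightarrow>\<^sub>L 'w) \<Rightarrow> (real \<Rightarrow> 'v \<Rightarrow>\<^sub>L ('u \<Rightarrow>\<^sub>L 'w)) \<Rightarrow>
     (real \<Rightarrow> 'u::real_normed_vector) \<Rightarrow> (real \<Rightarrow> 'v \<Rightarrow>\<^sub>L 'u) \<Rightarrow> real \<Rightarrow> real \<Rightarrow>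
     'w::real_normed_vector" where
  "rough_integral tens XX G G' Z Z' s t =
     Lim (partition_filter s t) (rough_sum tens XX G G' Z Z')"


section \<open>Bounded differentiable maps\<close>

text \<open>The Frechet derivative as a map into the space of bounded linear maps (meaningful if \<open>F\<close> is
  differentiable), so that it can be iterated.\<close>

definition frechet_map ::
  "('a::real_normed_vector \<Rightarrow> 'b::real_normed_vector) \<Rightarrow> 'a \<Rightarrow> 'a \<Rightarrow>\<^sub>L 'b" where
  "frechet_map F x = Blinfun (frechet_derivative F (at x))"

definition C3b :: "('a::real_normed_vector \<Rightarrow> 'b::real_normed_vector) \<Rightarrow> bool" where
  "C3b F \<longleftrightarrow>
     (\<forall>x. F differentiable (at x)) \<and>
     (\<forall>x. frechet_map F differentiable (at x)) \<and>
     (\<forall>x. frechet_map (frechet_map F) differentiable (at x)) \<and>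
     continuous_on UNIV (frechet_map (frechet_map (frechet_map F))) \<and>
     bounded (range F) \<and>
     bounded (range (frechet_map F)) \<and>
     bounded (range (frechet_map (frechet_map F))) \<and>
     bounded (range (frechet_map (frechet_map (frechet_map F))))"


section \<open>Rough differential equations\<close>

text \<open>\<open>(Y, Y')\<close> is a controlled solution on \<open>[0, T]\<close> of \<open>dY = F(Y) d(Z, Z')\<close> with initial value
  \<open>y0\<close>; the integrand is the controlled path \<open>(F(Y), DF(Y) Y')\<close>.\<close>

definition rde_solution ::
  "('v::real_normed_vector \<Rightarrow> 'v \<Rightarrow> 'vv::real_normed_vector) \<Rightarrow> real \<Rightarrow> real \<Rightarrow>
     (real \<Rightarrow> real \<Rightarrow> 'v) \<Rightarrow> (real \<Rightarrow> real \<Rightarrow> 'vv) \<Rightarrow>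
     (real \<Rightarrow> 'u::real_normed_vector) \<Rightarrow> (real \<Rightarrow> 'v \<Rightarrow>\<^sub>L 'u) \<Rightarrow>
     ('w::real_normed_vector \<Rightarrow> 'u \<Rightarrow>\<^sub>L 'w) \<Rightarrow> 'w \<Rightarrow> (real \<Rightarrow> 'w) \<Rightarrow> (real \<Rightarrow> 'v \<Rightarrow>\<^sub>L 'w) \<Rightarrow> bool" where
  "rde_solution tens \<alpha> T X XX Z Z' F y0 Y Y' \<longleftrightarrow>
     controlled_path \<alpha> T X Y Y' \<and>
     (\<forall>t\<in>{0..T}.
        Y t = y0 + rough_integral tens XX
                     (\<lambda>r. F (Y r)) (\<lambda>r. frechet_map F (Y r) o\<^sub>L Y' r) Z Z' 0 t \<and>
        Y' t = F (Y t) o\<^sub>L Z' t)"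

end

theory Submission
  imports Defs
begin

text \<open>
  Following Davie, a solution is a path \<open>Y\<close> with \<open>Y t - Y s = A s t (Y s) + O(\<bar>t - s\<bar> powr (3 * \<alpha>))\<close>,
  where the germ is \<open>A s t y = F y (Z t - Z s) + (DF y (F y (Z' s _)) (Z' s _)) (XX s t)\<close>.
  Chen's relation makes \<open>A s t y - A s u y - A u t (y + A s u y)\<close> of size \<open>\<bar>t - s\<bar> powr (3 * \<alpha>)\<close> and
  Lipschitz in \<open>y\<close> with a constant of this size, because \<open>F\<close> has three bounded derivatives. As
  \<open>3 * \<alpha> > 1\<close>, a sewing argument shows that on short intervals the Euler schemes of a germ with these
  properties satisfy Davie's estimate uniformly, and that two such paths stay close if their
  one-step errors are close. Hence Euler schemes on finer and finer grids converge and the limit is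
  unique; short intervals are glued together, with a step size that does not depend on the initial value.

  Davie's estimate implies that the compensated Riemann sums of \<open>F(Y)\<close> converge to the increments
  of \<open>Y\<close>. Conversely, along a given solution the germ \<open>A s t (Y s)\<close>, which no longer depends on the
  state, can be sewn as well, and its sewing is the rough integral; so solutions satisfy Davie's
  estimate.
\<close>

section \<open>Sewing on finite grids\<close>

text \<open>Sewing takes place on finite sets of times, where it is an induction with a constant
  that does not see the number of points; limits enter only when Euler schemes on different grids
  are compared. That comparison is the obstacle. Subtracting the equations of two paths leaves the
  difference of the increments \<open>A u t (p + r) - A u t p\<close> and
  \<open>A u t (q + r') - A u t q\<close>. A Lipschitz bound on \<open>A u t\<close> alone estimates
  it by the sizes of the errors \<open>r\<close> and \<open>r'\<close>, whereas the argument closes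
  only with \<open>r - r'\<close> and a term proportional to the distance of the paths. Hence the
  bound on second differences of the germ, and, for the same reason, a defect that is Lipschitz in
  the state. In the germ of the equation the defect contains the Taylor remainder of
  \<open>F\<close>; its Lipschitz dependence on the state rests on a second difference bound for
  \<open>DF\<close>, and this is where the third derivative enters. The tensor extension is defined
  by \<open>THE\<close> and the integral by \<open>Lim\<close>, so both say something only after
  existence, uniqueness and convergence have been proved.\<close>

lemma small_powr_ex:
  fixes C e \<alpha> :: real
  assumes "0 \<le> C" "0 < e" "0 < \<alpha>"
  obtains h where "0 < h" "h \<le> 1" "\<And>x. 0 \<le> x \<Longrightarrow> x \<le> h \<Longrightarrow> C * x powr \<alpha> \<le> e"
proof
  define h where "h = min 1 ((e / (C + 1)) powr (1 / \<alpha>))"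
  show "0 < h" "h \<le> 1" using assms by (auto simp: h_def)
  fix x assume x: "0 \<le> x" "x \<le> h"
  have "x powr \<alpha> \<le> ((e / (C + 1)) powr (1 / \<alpha>)) powr \<alpha>"
    using x assms by (intro powr_mono2) (auto simp: h_def)
  also have "\<dots> = e / (C + 1)" using assms by (simp add: powr_powr)
  finally have "C * x powr \<alpha> \<le> C * (e / (C + 1))" using assms by (intro mult_left_mono) auto
  also have "\<dots> \<le> e" using assms by (simp add: field_simps)
  finally show "C * x powr \<alpha> \<le> e" .
qed

definition consecutive :: "real set \<Rightarrow> real \<Rightarrow> real \<Rightarrow> bool" where
  "consecutive P s t \<longleftrightarrow> s \<in> P \<and> t \<in> P \<and> s < t \<and> P \<inter> {s<..<t} = {}"

lemma consecutiveD: "consecutive P s t \<Longrightarrow> s \<in> P" "consecutive P s t \<Longrightarrow> t \<in> P"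
  "consecutive P s t \<Longrightarrow> s < t"
  by (auto simp: consecutive_def)

text \<open>Cutting an interval near its midpoint leaves two pieces of at most half the length.
  Their contributions add up to the factor \<open>(2 + \<eta>) / 2 powr \<theta>\<close>, which is
  below 1, so the constant reproduces itself however many points \<open>P\<close> has. The one-sided
  factor \<open>1 + \<eta>\<close> makes room for germs that depend on the state: an error made on
  the left piece is carried through the right one.\<close>

lemma discrete_sewing:
  fixes g :: "real \<Rightarrow> real \<Rightarrow> real"
  assumes fin: "finite P"
    and refl: "\<And>s. s \<in> P \<Longrightarrow> g s s = 0"
    and sub: "\<And>s u t. \<lbrakk>s \<in> P; u \<in> P; t \<in> P; s \<le> u; u \<le> t\<rbrakk> \<Longrightarrow>
        g s t \<le> (1 + \<eta>) * g s u + g u t + B * (t - s) powr \<theta>"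
    and con: "\<And>s t. consecutive P s t \<Longrightarrow> g s t \<le> \<epsilon> * (t - s) powr \<theta>"
    and \<eta>: "0 \<le> \<eta>" "\<eta> \<le> 1" and \<kappa>: "(2 + \<eta>) / 2 powr \<theta> \<le> \<kappa>" "\<kappa> < 1"
    and pos: "0 \<le> B" "0 \<le> \<epsilon>" "0 < \<theta>"
    and st: "s \<in> P" "t \<in> P" "s \<le> t"
  shows "g s t \<le> 2 * (B + \<epsilon>) / (1 - \<kappa>) * (t - s) powr \<theta>"
proof -
  \<comment> \<open>The fixed point of the recursion
    \<open>K = \<kappa> * K + 2 * B + 2 * \<epsilon>\<close> that the cut produces.\<close>
  define K where "K = 2 * (B + \<epsilon>) / (1 - \<kappa>)"
  have \<kappa>0: "0 \<le> \<kappa>" using \<eta> \<kappa>(1) by (smt (verit) divide_nonneg_nonneg powr_ge_zero)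
  have K0: "0 \<le> K" using \<kappa> pos by (simp add: K_def)
  have K: "\<kappa> * K + 2 * B + 2 * \<epsilon> = K" using \<kappa> by (simp add: K_def field_simps)
  have K\<epsilon>: "\<epsilon> \<le> K" using K K0 \<kappa>0 pos by (smt (verit) mult_nonneg_nonneg)
  have "g s t \<le> K * (t - s) powr \<theta>" if "s \<in> P" "t \<in> P" "s \<le> t" for s t
    using that
  proof (induction "card (P \<inter> {s<..<t})" arbitrary: s t rule: less_induct)
    case less
    show ?case
    proof (cases "s = t")
      case True
      then show ?thesis using refl less.prems pos by simp
    next
      case False
      then have lt: "s < t" using less.prems by simp
      show ?thesis
      proof (cases "P \<inter> {s<..<t} = {}")
        case True
        then have "g s t \<le> \<epsilon> * (t - s) powr \<theta>"
          using con lt less.prems by (auto simp: consecutive_def)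
        also have "\<dots> \<le> K * (t - s) powr \<theta>" using K\<epsilon> by (intro mult_right_mono) auto
        finally show ?thesis .
      next
        case False
        \<comment> \<open>The midpoint need not lie in \<open>P\<close>. Its neighbours
          \<open>m\<close> and \<open>m'\<close> in \<open>P\<close> do; the gap between them is a
          single step, controlled by \<epsilon>, and the outer pieces have at most half the
          length.\<close>
        define c where "c = (s + t) / 2"
        define S1 where "S1 = {p \<in> P. s \<le> p \<and> p \<le> c}"
        define S2 where "S2 = {p \<in> P. c < p \<and> p \<le> t}"
        have f1: "finite S1" "s \<in> S1" and f2: "finite S2" "t \<in> S2"
          using fin lt less.prems by (auto simp: S1_def S2_def c_def)
        define m where "m = Max S1"
        define m' where "m' = Min S2"
        have m: "m \<in> S1" unfolding m_def using f1 by (intro Max_in) auto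
        have m': "m' \<in> S2" unfolding m'_def using f2 by (intro Min_in) auto
        have mP: "m \<in> P" "s \<le> m" "m \<le> c" and m'P: "m' \<in> P" "c < m'" "m' \<le> t"
          using m m' by (auto simp: S1_def S2_def)
        have ub: "p \<le> m" if "p \<in> S1" for p using f1 that by (simp add: m_def)
        have lb: "m' \<le> p" if "p \<in> S2" for p using f2 that by (simp add: m'_def)
        have cons: "consecutive P m m'"
          using mP m'P ub lb unfolding consecutive_def S1_def S2_def
          by (auto simp: set_eq_iff) (smt (verit))
        have fin': "finite (P \<inter> {s<..<t})" using fin by simp
        have mt: "m < t" "s < m'" using mP m'P lt by (auto simp: c_def)
        have half: "r powr \<theta> \<le> (t - s) powr \<theta> / 2 powr \<theta>" if "0 \<le> r" "r \<le> (t - s) / 2" for r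
        proof -
          have "r powr \<theta> \<le> ((t - s) / 2) powr \<theta>" using that pos by (intro powr_mono2) auto
          then show ?thesis using lt by (simp add: powr_divide)
        qed
        have g1: "g s m \<le> K * ((t - s) powr \<theta> / 2 powr \<theta>)"
        proof (cases "m = s")
          case True
          then show ?thesis using refl less.prems K0 by simp
        next
          case False
          then have "m \<in> P \<inter> {s<..<t}" using mP mt by auto
          moreover have "P \<inter> {s<..<m} \<subseteq> P \<inter> {s<..<t} - {m}" using mt by auto
          ultimately have "card (P \<inter> {s<..<m}) < card (P \<inter> {s<..<t})"
            by (intro psubset_card_mono[OF fin']) auto
          then have "g s m \<le> K * (m - s) powr \<theta>" using less mP by auto
          also have "\<dots> \<le> K * ((t - s) powr \<theta> / 2 powr \<theta>)"
            using mP K0 by (intro mult_left_mono half) (auto simp: c_def field_simps)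
          finally show ?thesis .
        qed
        have g2: "g m' t \<le> K * ((t - s) powr \<theta> / 2 powr \<theta>)"
        proof (cases "m' = t")
          case True
          then show ?thesis using refl less.prems K0 by simp
        next
          case False
          then have "m' \<in> P \<inter> {s<..<t}" using m'P mt by auto
          moreover have "P \<inter> {m'<..<t} \<subseteq> P \<inter> {s<..<t} - {m'}" using mt by auto
          ultimately have "card (P \<inter> {m'<..<t}) < card (P \<inter> {s<..<t})"
            by (intro psubset_card_mono[OF fin']) auto
          then have "g m' t \<le> K * (t - m') powr \<theta>" using less m'P by auto
          also have "\<dots> \<le> K * ((t - s) powr \<theta> / 2 powr \<theta>)"
            using m'P K0 by (intro mult_left_mono half) (auto simp: c_def field_simps)
          finally show ?thesis .
        qed
        have mono: "r powr \<theta> \<le> (t - s) powr \<theta>" if "0 \<le> r" "r \<le> t - s" for r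
          using that pos by (intro powr_mono2) auto
        have g3: "g m m' \<le> \<epsilon> * (t - s) powr \<theta>"
          using con[OF cons] mono[of "m' - m"] mP m'P mult_left_mono[OF _ pos(2)]
          by (smt (verit))
        have g4: "g s t \<le> (1 + \<eta>) * g s m + g m t + B * (t - s) powr \<theta>"
          using sub[of s m t] less.prems mP mt by auto
        have "g m t \<le> (1 + \<eta>) * g m m' + g m' t + B * (t - m) powr \<theta>"
          using sub[of m m' t] less.prems mP m'P by auto
        also have "B * (t - m) powr \<theta> \<le> B * (t - s) powr \<theta>"
          using pos mP mt by (intro mult_left_mono mono) auto
        also have "(1 + \<eta>) * g m m' \<le> 2 * (\<epsilon> * (t - s) powr \<theta>)"
        proof -
          have "(1 + \<eta>) * g m m' \<le> (1 + \<eta>) * (\<epsilon> * (t - s) powr \<theta>)"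
            using g3 \<eta> by (intro mult_left_mono) auto
          also have "\<dots> \<le> 2 * (\<epsilon> * (t - s) powr \<theta>)"
            using \<eta> pos by (intro mult_right_mono) auto
          finally show ?thesis .
        qed
        finally have g5: "g m t \<le> 2 * (\<epsilon> * (t - s) powr \<theta>) + g m' t + B * (t - s) powr \<theta>"
          by simp
        have g6: "(1 + \<eta>) * g s m \<le> (1 + \<eta>) * (K * ((t - s) powr \<theta> / 2 powr \<theta>))"
          using g1 \<eta> by (intro mult_left_mono) auto
        have "(2 + \<eta>) / 2 powr \<theta> * K * (t - s) powr \<theta> =
            K * ((t - s) powr \<theta> / 2 powr \<theta>) + (1 + \<eta>) * (K * ((t - s) powr \<theta> / 2 powr \<theta>))"
          by (simp add: algebra_simps add_divide_distrib)
        then have "g s t \<le> (2 + \<eta>) / 2 powr \<theta> * K * (t - s) powr \<theta> + (2 * B + 2 * \<epsilon>) * (t - s) powr \<theta>"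
          using g4 g5 g6 g2 by (simp only: distrib_right mult.assoc)
        also have "(2 + \<eta>) / 2 powr \<theta> * K * (t - s) powr \<theta> \<le> \<kappa> * K * (t - s) powr \<theta>"
          using \<kappa> K0 by (intro mult_right_mono) auto
        finally have "g s t \<le> (\<kappa> * K + 2 * B + 2 * \<epsilon>) * (t - s) powr \<theta>"
          by (simp add: algebra_simps)
        then show ?thesis by (simp add: K)
      qed
    qed
  qed
  then show ?thesis using st unfolding K_def by blast
qed

text \<open>The place where \<theta> > 1 is spent: \<open>2 powr \<theta>\<close> exceeds 2, and
  \<eta> takes up at most half of the excess.\<close>

lemma sewing_constants:
  fixes \<theta> :: real
  assumes "1 < \<theta>"
  obtains \<eta> \<kappa> where "0 < \<eta>" "\<eta> \<le> 1" "(2 + \<eta>) / 2 powr \<theta> \<le> \<kappa>" "\<kappa> < 1"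
proof -
  have "2 powr 1 < 2 powr \<theta>" using assms by (intro powr_less_mono) auto
  then show ?thesis
    by (intro that[of "min 1 ((2 powr \<theta> - 2) / 2)" "(2 + min 1 ((2 powr \<theta> - 2) / 2)) / 2 powr \<theta>"])
      (auto simp: min_def field_simps)
qed

text \<open>Fineness is stated for arbitrary gaps in \<open>P\<close> so that it passes to supersets of \<open>P\<close>.\<close>

definition fine_grid :: "real \<Rightarrow> real \<Rightarrow> real \<Rightarrow> real set \<Rightarrow> bool" where
  "fine_grid a b d P \<longleftrightarrow> finite P \<and> P \<subseteq> {a..b} \<and> a \<in> P \<and>
     (\<forall>s t. a \<le> s \<and> s < t \<and> t \<le> b \<and> P \<inter> {s<..<t} = {} \<longrightarrow> t - s \<le> d)"

lemma fine_grid_ex: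
  assumes "a \<le> b" "0 < d"
  shows "\<exists>P. fine_grid a b d P"
proof -
  obtain n :: nat where "(b - a) / d \<le> real n" using real_arch_simple by blast
  then have "b - a \<le> real n * d" using assms by (simp add: field_simps)
  then show ?thesis using assms(1)
  proof (induction n arbitrary: a)
    case 0
    then show ?case by (intro exI[of _ "{a}"]) (auto simp: fine_grid_def)
  next
    case (Suc n)
    show ?case
    proof (cases "b - a \<le> d")
      case True
      then show ?thesis using Suc.prems by (intro exI[of _ "{a}"]) (auto simp: fine_grid_def)
    next
      case False
      then obtain P where P: "fine_grid (a + d) b d P"
        using Suc.IH[of "a + d"] Suc.prems by (auto simp: algebra_simps)
      have "t - s \<le> d" if "a \<le> s" "s < t" "t \<le> b" "insert a P \<inter> {s<..<t} = {}" for s t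
      proof (cases "a + d \<le> s")
        case True
        then show ?thesis using P that by (auto simp: fine_grid_def)
      next
        case False
        moreover have "a + d \<in> P" using P by (auto simp: fine_grid_def)
        ultimately have "t \<le> a + d" using that by (auto simp: set_eq_iff not_less)
        then show ?thesis using that by simp
      qed
      then have "fine_grid a b d (insert a P)"
        using P False assms by (auto simp: fine_grid_def)
      then show ?thesis by blast
    qed
  qed
qed

text \<open>Used for common refinements of two grids and for inserting prescribed times into a
  grid.\<close>

lemma fine_grid_superset:
  assumes "fine_grid a b d P" "finite Q" "P \<subseteq> Q" "Q \<subseteq> {a..b}"
  shows "fine_grid a b d Q"
  unfolding fine_grid_def
proof (intro conjI allI impI)
  fix s t assume "a \<le> s \<and> s < t \<and> t \<le> b \<and> Q \<inter> {s<..<t} = {}"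
  then have "a \<le> s \<and> s < t \<and> t \<le> b \<and> P \<inter> {s<..<t} = {}" using assms(3) by blast
  then show "t - s \<le> d" using assms(1) unfolding fine_grid_def by blast
qed (use assms in \<open>auto simp: fine_grid_def\<close>)

lemma fine_gridD:
  assumes "fine_grid a b d P"
  shows "finite P" "P \<subseteq> {a..b}" "a \<in> P" "consecutive P s t \<Longrightarrow> t - s \<le> d"
  using assms unfolding fine_grid_def consecutive_def by (auto simp: subset_iff)

section \<open>Nonlinear sewing\<close>

text \<open>For a germ that ignores its state this is \<open>A s t - A s u - A u t\<close>, the
  coboundary of the classical sewing lemma. In general the second step starts from the state
  predicted by the first.\<close>

definition germ_defect ::
    "(real \<Rightarrow> real \<Rightarrow> 'w \<Rightarrow> 'w) \<Rightarrow> real \<Rightarrow> real \<Rightarrow> real \<Rightarrow> 'w \<Rightarrow> 'w::real_normed_vector" where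
  "germ_defect A s u t y = A s t y - A s u y - A u t (y + A s u y)"

definition deviation ::
    "(real \<Rightarrow> real \<Rightarrow> 'w \<Rightarrow> 'w) \<Rightarrow> (real \<Rightarrow> 'w) \<Rightarrow> real \<Rightarrow> real \<Rightarrow> 'w::real_normed_vector" where
  "deviation A Y s t = Y t - Y s - A s t (Y s)"

definition davie_path ::
    "(real \<Rightarrow> real \<Rightarrow> 'w \<Rightarrow> 'w) \<Rightarrow> real \<Rightarrow> real \<Rightarrow> real \<Rightarrow> real \<Rightarrow> (real \<Rightarrow> 'w::real_normed_vector) \<Rightarrow> bool" where
  "davie_path A \<theta> K a b Y \<longleftrightarrow>
     (\<forall>s t. a \<le> s \<and> s \<le> t \<and> t \<le> b \<longrightarrow> norm (deviation A Y s t) \<le> K * (t - s) powr \<theta>)"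

lemma davie_pathD:
  "davie_path A \<theta> K a b Y \<Longrightarrow> a \<le> s \<Longrightarrow> s \<le> t \<Longrightarrow> t \<le> b \<Longrightarrow>
    norm (deviation A Y s t) \<le> K * (t - s) powr \<theta>"
  by (auto simp: davie_path_def)

lemma davie_path_mono:
  assumes "davie_path A \<theta> K a b Y" "K \<le> L"
  shows "davie_path A \<theta> L a b Y"
  using assms unfolding davie_path_def by (meson mult_right_mono order_trans powr_ge_zero)

section \<open>Euler schemes: uniform error bound and stability\<close>

lemma euler_path_ex:
  fixes A :: "real \<Rightarrow> real \<Rightarrow> 'w \<Rightarrow> 'w::real_normed_vector"
  assumes "finite P" "a \<in> P" "P \<subseteq> {a..}"
  shows "\<exists>Y. Y a = y \<and> (\<forall>s t. consecutive P s t \<longrightarrow> deviation A Y s t = 0)"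
proof -
  have "\<exists>Y. Y a = y \<and> (\<forall>s t. consecutive (insert a Q) s t \<longrightarrow> deviation A Y s t = 0)"
    if "finite Q" "\<forall>p\<in>Q. a < p" for Q
    using that
  proof (induction Q rule: finite_linorder_max_induct)
    case empty
    then show ?case by (auto simp: consecutive_def)
  next
    case (insert b Q)
    then obtain Y where Y: "Y a = y"
      "\<And>s t. consecutive (insert a Q) s t \<Longrightarrow> deviation A Y s t = 0" by auto
    define m where "m = Max (insert a Q)"
    have m: "m \<in> insert a Q" unfolding m_def using insert by (intro Max_in) auto
    have ub: "p \<le> m" if "p \<in> insert a Q" for p
      unfolding m_def using insert that by (intro Max_ge) auto
    have lt: "p < b" if "p \<in> insert a Q" for p using insert that by auto
    \<comment> \<open>The only consecutive pair ending at the new largest point \<open>b\<close> is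
      \<open>(m, b)\<close>, so its value is free to be set by one Euler step from
      \<open>m\<close>.\<close>
    define Y2 where "Y2 = Y(b := Y m + A m b (Y m))"
    have "deviation A Y2 s t = 0" if c: "consecutive (insert a (insert b Q)) s t" for s t
    proof (cases "t = b")
      case True
      have "s \<in> insert a Q" using c True by (auto simp: consecutive_def)
      moreover have "\<not> s < m" using c True m lt[OF m] by (auto simp: consecutive_def set_eq_iff)
      ultimately have "s = m" using ub by force
      then show ?thesis using True lt[OF m] by (auto simp: deviation_def Y2_def)
    next
      case False
      then have t: "t \<in> insert a Q" using c by (auto simp: consecutive_def)
      then have "s \<in> insert a Q" "s \<noteq> b" using c lt by (force simp: consecutive_def)+
      then have "consecutive (insert a Q) s t" using c t by (auto simp: consecutive_def)
      then show ?thesis using Y(2) \<open>s \<noteq> b\<close> False by (auto simp: deviation_def Y2_def)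
    qed
    moreover have "Y2 a = y" using Y lt by (auto simp: Y2_def)
    ultimately show ?case by auto
  qed
  moreover have "\<forall>p\<in>P - {a}. a < p" using assms by force
  ultimately show ?thesis using assms by (metis finite_Diff insert_Diff)
qed

text \<open>The bound \<open>four_point\<close> is what a map with bounded and Lipschitz derivative
  of size \<open>C * (t - s) powr \<alpha>\<close> satisfies; equal base points and
  \<open>q = 0\<close> give back the Lipschitz bound. It is the only regularity in the state that
  comparing two paths requires of a single step.\<close>

locale davie_germ =
  fixes A :: "real \<Rightarrow> real \<Rightarrow> 'w \<Rightarrow> 'w::banach" and T C \<alpha> \<theta> :: real
  assumes exponents: "0 < \<alpha>" "1 < \<theta>" and C_nonneg: "0 \<le> C"
    and diagonal: "\<lbrakk>0 \<le> s; s \<le> T\<rbrakk> \<Longrightarrow> A s s y = 0"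
    and four_point: "\<lbrakk>0 \<le> s; s \<le> t; t \<le> T\<rbrakk> \<Longrightarrow>
        norm ((A s t (y + r) - A s t y) - (A s t (z + q) - A s t z))
          \<le> C * (t - s) powr \<alpha> * (norm (r - q) + norm q * norm (y - z))"
    and defect: "\<lbrakk>0 \<le> s; s \<le> u; u \<le> t; t \<le> T\<rbrakk> \<Longrightarrow>
        norm (germ_defect A s u t y) \<le> C * (t - s) powr \<theta>"
    and defect_lipschitz: "\<lbrakk>0 \<le> s; s \<le> u; u \<le> t; t \<le> T\<rbrakk> \<Longrightarrow>
        norm (germ_defect A s u t y - germ_defect A s u t z) \<le> C * (t - s) powr \<theta> * norm (y - z)"
begin

lemma germ_lipschitz:
  assumes "0 \<le> s" "s \<le> t" "t \<le> T"
  shows "norm (A s t y - A s t z) \<le> C * (t - s) powr \<alpha> * norm (y - z)"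
  using four_point[OF assms, of z "y - z" z 0] by simp

text \<open>The last bracket evaluates the germ at the true state \<open>Y u\<close> and at the
  predicted state \<open>Y s + A s u (Y s)\<close>. These two differ exactly by
  \<open>deviation A Y s u\<close>, which produces the factor in front of the left piece in the
  sewing inequality.\<close>

lemma deviation_split:
  "deviation A Y s t = deviation A Y s u + deviation A Y u t - germ_defect A s u t (Y s)
     + (A u t (Y u) - A u t (Y s + A s u (Y s)))"
  by (simp add: deviation_def germ_defect_def)

lemma deviation_subadditive:
  assumes "0 \<le> s" "s \<le> u" "u \<le> t" "t \<le> T"
  shows "norm (deviation A Y s t) \<le> (1 + C * (t - u) powr \<alpha>) * norm (deviation A Y s u)
           + norm (deviation A Y u t) + C * (t - s) powr \<theta>"
proof -
  have "Y u - (Y s + A s u (Y s)) = deviation A Y s u" by (simp add: deviation_def)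
  then have "norm (A u t (Y u) - A u t (Y s + A s u (Y s)))
      \<le> C * (t - u) powr \<alpha> * norm (deviation A Y s u)"
    using germ_lipschitz[of u t "Y u" "Y s + A s u (Y s)"] assms by simp
  moreover have "norm (germ_defect A s u t (Y s)) \<le> C * (t - s) powr \<theta>"
    using defect assms by blast
  moreover have "norm (deviation A Y s t) \<le> norm (deviation A Y s u) + norm (deviation A Y u t)
      + norm (germ_defect A s u t (Y s)) + norm (A u t (Y u) - A u t (Y s + A s u (Y s)))"
    unfolding deviation_split[of Y s t u] by norm
  ultimately show ?thesis by (simp add: algebra_simps)
qed

text \<open>On intervals so short that \<open>C * x powr \<alpha>\<close> stays below \<eta>, the
  deviation satisfies the hypotheses of \<open>discrete_sewing\<close> with \<epsilon> = 0, because
  Euler steps are exact. Neither the grid nor the starting value enters the constants.\<close>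

lemma euler_path_bound:
  obtains h K where "0 < h" "0 \<le> K"
    "\<And>a b P Y s t. \<lbrakk>0 \<le> a; b \<le> T; b - a \<le> h; finite P; P \<subseteq> {a..b};
       \<And>s t. consecutive P s t \<Longrightarrow> deviation A Y s t = 0; s \<in> P; t \<in> P; s \<le> t\<rbrakk>
       \<Longrightarrow> norm (deviation A Y s t) \<le> K * (t - s) powr \<theta>"
proof -
  obtain \<eta> \<kappa> where \<eta>: "0 < \<eta>" "\<eta> \<le> 1" and \<kappa>: "(2 + \<eta>) / 2 powr \<theta> \<le> \<kappa>" "\<kappa> < 1"
    using sewing_constants exponents by blast
  obtain h where h: "0 < h" "h \<le> 1" "\<And>x. 0 \<le> x \<Longrightarrow> x \<le> h \<Longrightarrow> C * x powr \<alpha> \<le> \<eta>"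
    using small_powr_ex C_nonneg \<eta>(1) exponents(1) by metis
  show ?thesis
  proof (rule that[of h "2 * (C + 0) / (1 - \<kappa>)"])
    show "0 < h" "0 \<le> 2 * (C + 0) / (1 - \<kappa>)" using h \<kappa> C_nonneg by auto
    fix a b P Y s t
    assume *: "0 \<le> a" "b \<le> T" "b - a \<le> h" "finite P" "P \<subseteq> {a..b}"
      and con: "\<And>s t. consecutive P s t \<Longrightarrow> deviation A Y s t = 0"
      and st: "s \<in> P" "t \<in> P" "s \<le> t"
    show "norm (deviation A Y s t) \<le> 2 * (C + 0) / (1 - \<kappa>) * (t - s) powr \<theta>"
    proof (rule discrete_sewing[where g = "\<lambda>s t. norm (deviation A Y s t)" and \<eta> = \<eta>])
      show "norm (deviation A Y s s) = 0" if "s \<in> P" for s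
        using that * diagonal by (auto simp: deviation_def)
      fix s u t assume s: "s \<in> P" "u \<in> P" "t \<in> P" "s \<le> u" "u \<le> t"
      then have "a \<le> s" "t \<le> b" using * by auto
      then have r: "0 \<le> s" "t \<le> T" "t - u \<le> h" using * s by linarith+
      have "(1 + C * (t - u) powr \<alpha>) * norm (deviation A Y s u) \<le> (1 + \<eta>) * norm (deviation A Y s u)"
        using h(3)[of "t - u"] s r by (intro mult_right_mono) auto
      with deviation_subadditive[of s u t Y] s r
      show "norm (deviation A Y s t) \<le> (1 + \<eta>) * norm (deviation A Y s u)
           + norm (deviation A Y u t) + C * (t - s) powr \<theta>" by linarith
    qed (use con st * \<eta> \<kappa> C_nonneg exponents in auto)
  qed
qed

text \<open>The exponent \<open>\<theta>\<close> is lowered so that steps whose error is only bounded by a multiple of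
  \<open>(t - s) powr \<theta>\<close> become small perturbations on fine grids.\<close>

definition \<theta>' :: real where "\<theta>' = (1 + \<theta>) / 2"

lemma exponent_between: "1 < \<theta>'" "\<theta>' < \<theta>"
  using exponents by (auto simp: \<theta>'_def)

text \<open>Here the difference of the two deviations is sewn. Its sewing constant is linear in the
  largest distance \<open>M\<close> of the paths and in \<epsilon>, and on short intervals the part
  with \<open>M\<close> is absorbed on the left.\<close>

lemma davie_path_stability:
  assumes "0 \<le> K"
  obtains h where "0 < h"
    "\<And>a b P Y Z \<epsilon> t. \<lbrakk>0 \<le> a; b \<le> T; b - a \<le> h; finite P; P \<subseteq> {a..b}; a \<in> P; Y a = Z a;
       \<And>s t. \<lbrakk>s \<in> P; t \<in> P; s \<le> t\<rbrakk> \<Longrightarrow> norm (deviation A Z s t) \<le> K * (t - s) powr \<theta>;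
       \<And>s t. consecutive P s t \<Longrightarrow>
         norm (deviation A Y s t - deviation A Z s t) \<le> \<epsilon> * (t - s) powr \<theta>';
       0 \<le> \<epsilon>; t \<in> P\<rbrakk> \<Longrightarrow> norm (Y t - Z t) \<le> \<epsilon>"
proof -
  obtain \<eta> \<kappa> where \<eta>: "0 < \<eta>" "\<eta> \<le> 1" and \<kappa>: "(2 + \<eta>) / 2 powr \<theta>' \<le> \<kappa>" "\<kappa> < 1"
    using sewing_constants exponent_between by blast
  define K1 where "K1 = 2 * (C + 2 * K + 1) / (1 - \<kappa>)"
  have K1: "0 \<le> K1" using \<kappa> C_nonneg assms by (simp add: K1_def)
  obtain h1 where h1: "0 < h1" "h1 \<le> 1" "\<And>x. 0 \<le> x \<Longrightarrow> x \<le> h1 \<Longrightarrow> C * x powr \<alpha> \<le> \<eta>"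
    using small_powr_ex C_nonneg \<eta>(1) exponents(1) by metis
  obtain h2 where h2: "0 < h2" "h2 \<le> 1" "\<And>x. 0 \<le> x \<Longrightarrow> x \<le> h2 \<Longrightarrow> K1 * x powr \<theta>' \<le> 1 / 4"
    using small_powr_ex[of K1 "1/4" \<theta>'] K1 exponent_between by auto
  show ?thesis
  proof (rule that[of "min h1 h2"])
    show "0 < min h1 h2" using h1 h2 by simp
    fix a b P Y Z \<epsilon> t
    assume ab: "0 \<le> a" "b \<le> T" "b - a \<le> min h1 h2" and P: "finite P" "P \<subseteq> {a..b}" "a \<in> P"
      and init: "Y a = Z a"
      and dZ: "\<And>s t. \<lbrakk>s \<in> P; t \<in> P; s \<le> t\<rbrakk> \<Longrightarrow> norm (deviation A Z s t) \<le> K * (t - s) powr \<theta>"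
      and con: "\<And>s t. consecutive P s t \<Longrightarrow>
         norm (deviation A Y s t - deviation A Z s t) \<le> \<epsilon> * (t - s) powr \<theta>'"
      and \<epsilon>: "0 \<le> \<epsilon>" and t: "t \<in> P"
    define M where "M = Max ((\<lambda>t. norm (Y t - Z t)) ` P)"
    have M: "norm (Y t - Z t) \<le> M" if "t \<in> P" for t
      unfolding M_def using P that by (intro Max_ge) auto
    have "M \<in> (\<lambda>t. norm (Y t - Z t)) ` P" unfolding M_def using P by (intro Max_in) auto
    then obtain tm where tm: "tm \<in> P" "M = norm (Y tm - Z tm)" by auto
    have M0: "0 \<le> M" using tm by simp
    define D where "D s t = norm (deviation A Y s t - deviation A Z s t)" for s t
    have DK: "D s t \<le> 2 * ((C + 2 * K) * M + \<epsilon>) / (1 - \<kappa>) * (t - s) powr \<theta>'"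
      if "s \<in> P" "t \<in> P" "s \<le> t" for s t
    proof (rule discrete_sewing[where g = D and \<eta> = \<eta> and P = P])
      show "D s s = 0" if "s \<in> P" for s
        using that ab P diagonal by (auto simp: deviation_def D_def)
      fix s u t assume s: "s \<in> P" "u \<in> P" "t \<in> P" "s \<le> u" "u \<le> t"
      then have "a \<le> s" "t \<le> b" using P by auto
      \<comment> \<open>Intervals of length at most 1 allow \<theta> to be replaced by the smaller
        exponent \<open>\<theta>'\<close>.\<close>
      then have r: "0 \<le> s" "t \<le> T" "t - u \<le> h1" "u - s \<le> h1" "t - s \<le> 1"
        using ab s h1 by linarith+
      have le: "x powr \<theta> \<le> (t - s) powr \<theta>'" if "0 \<le> x" "x \<le> t - s" for x
      proof -
        have "x powr \<theta> \<le> x powr \<theta>'"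
          using that r exponent_between by (cases "x = 0") (auto intro: powr_mono')
        also have "\<dots> \<le> (t - s) powr \<theta>'" using that exponent_between by (intro powr_mono2) auto
        finally show ?thesis .
      qed
      \<comment> \<open>The Euler predictions at time \<open>u\<close>. The four-point bound
        compares the steps from \<open>p\<close> and \<open>q\<close> to the true states; the errors
        enter through their difference and through the size of the second error times the distance
        of \<open>p\<close> and \<open>q\<close>, which is at most \<open>2 * M\<close>.\<close>
      define p where "p = Y s + A s u (Y s)"
      define q where "q = Z s + A s u (Z s)"
      have "norm (p - q) \<le> norm (Y s - Z s) + norm (A s u (Y s) - A s u (Z s))"
        unfolding p_def q_def by norm
      also have "\<dots> \<le> M + \<eta> * M"
      proof (intro add_mono M s)
        have "norm (A s u (Y s) - A s u (Z s)) \<le> C * (u - s) powr \<alpha> * norm (Y s - Z s)"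
          using germ_lipschitz s r by simp
        also have "\<dots> \<le> \<eta> * M" using h1(3)[of "u - s"] s r M \<eta> by (intro mult_mono) auto
        finally show "norm (A s u (Y s) - A s u (Z s)) \<le> \<eta> * M" .
      qed
      also have "\<dots> \<le> 2 * M" using \<eta> M0 by (simp add: mult_left_le_one_le)
      finally have pq: "norm (p - q) \<le> 2 * M" .
      have "norm ((A u t (p + deviation A Y s u) - A u t p) - (A u t (q + deviation A Z s u) - A u t q))
          \<le> C * (t - u) powr \<alpha> * (D s u + norm (deviation A Z s u) * norm (p - q))"
        unfolding D_def using four_point s r by simp
      also have "\<dots> \<le> \<eta> * (D s u + norm (deviation A Z s u) * norm (p - q))"
        using h1(3)[of "t - u"] s r by (intro mult_right_mono) (auto simp: D_def)
      also have "\<dots> \<le> \<eta> * D s u + norm (deviation A Z s u) * norm (p - q)"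
        using \<eta> by (simp add: distrib_left mult_left_le_one_le)
      also have "norm (deviation A Z s u) * norm (p - q) \<le> K * (t - s) powr \<theta>' * (2 * M)"
      proof (intro mult_mono pq)
        have "norm (deviation A Z s u) \<le> K * (u - s) powr \<theta>" using dZ s by simp
        also have "\<dots> \<le> K * (t - s) powr \<theta>'" using s assms by (intro mult_left_mono le) auto
        finally show "norm (deviation A Z s u) \<le> K * (t - s) powr \<theta>'" .
      qed (use assms in auto)
      finally have 1: "norm ((A u t (p + deviation A Y s u) - A u t p)
            - (A u t (q + deviation A Z s u) - A u t q))
          \<le> \<eta> * D s u + 2 * K * M * (t - s) powr \<theta>'" by (simp add: mult_ac)
      have "norm (germ_defect A s u t (Y s) - germ_defect A s u t (Z s))
          \<le> C * (t - s) powr \<theta> * norm (Y s - Z s)"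
        using defect_lipschitz s r by simp
      also have "\<dots> \<le> C * (t - s) powr \<theta>' * M"
        using s C_nonneg M by (intro mult_mono mult_left_mono le) auto
      finally have 2: "norm (germ_defect A s u t (Y s) - germ_defect A s u t (Z s))
          \<le> C * M * (t - s) powr \<theta>'" by (simp add: mult_ac)
      have pu: "p + deviation A Y s u = Y u" "q + deviation A Z s u = Z u"
        by (auto simp: p_def q_def deviation_def)
      have "D s t \<le> D s u + D u t + norm (germ_defect A s u t (Y s) - germ_defect A s u t (Z s))
          + norm ((A u t (Y u) - A u t p) - (A u t (Z u) - A u t q))"
        unfolding D_def deviation_split[of Y s t u] deviation_split[of Z s t u] p_def[symmetric] q_def[symmetric]
        by norm
      with 1 2 show "D s t \<le> (1 + \<eta>) * D s u + D u t + (C + 2 * K) * M * (t - s) powr \<theta>'"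
        unfolding pu by (simp add: algebra_simps)
    next
      fix s t assume "consecutive P s t"
      then show "D s t \<le> \<epsilon> * (t - s) powr \<theta>'" unfolding D_def by (rule con)
    qed (use P that \<eta> \<kappa> C_nonneg assms exponent_between M0 \<epsilon> in auto)
    \<comment> \<open>Both paths start at the same value, so the germs over the interval from
      \<open>a\<close> to \<open>tm\<close> cancel.\<close>
    have "M = norm (deviation A Y a tm - deviation A Z a tm)"
      using init tm by (simp add: deviation_def)
    also have "\<dots> = D a tm" by (simp add: D_def)
    also have "\<dots> \<le> 2 * ((C + 2 * K) * M + \<epsilon>) / (1 - \<kappa>) * (tm - a) powr \<theta>'"
      using DK P tm by (auto simp: subset_iff)
    also have "\<dots> \<le> (K1 * (M + \<epsilon>)) * (tm - a) powr \<theta>'"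
    proof (intro mult_right_mono)
      have "(C + 2 * K) * M + \<epsilon> \<le> (C + 2 * K + 1) * (M + \<epsilon>)"
        using C_nonneg assms M0 \<epsilon> by (simp add: algebra_simps)
      then show "2 * ((C + 2 * K) * M + \<epsilon>) / (1 - \<kappa>) \<le> K1 * (M + \<epsilon>)"
        using \<kappa> unfolding K1_def times_divide_eq_left mult.assoc
        by (intro divide_right_mono mult_left_mono) auto
    qed auto
    also have "\<dots> = (K1 * (tm - a) powr \<theta>') * (M + \<epsilon>)" by simp
    also have "\<dots> \<le> 1 / 4 * (M + \<epsilon>)"
    proof (intro mult_right_mono h2(3))
      show "0 \<le> tm - a" using P tm by auto
      have "tm \<le> b" using P tm by auto
      then show "tm - a \<le> h2" using ab by simp
    qed (use M0 \<epsilon> in auto)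
    finally have "M \<le> \<epsilon>" using M0 \<epsilon> by simp
    then show "norm (Y t - Z t) \<le> \<epsilon>" using M[OF t] by simp
  qed
qed

end

lemma fine_grid_mono: "fine_grid a b d P \<Longrightarrow> d \<le> e \<Longrightarrow> fine_grid a b e P"
  unfolding fine_grid_def by (meson order_trans)

section \<open>Convergence of Euler schemes; global existence and uniqueness of Davie paths\<close>

context davie_germ
begin

lemma germ_continuous:
  assumes "0 \<le> s" "s \<le> t" "t \<le> T"
  shows "isCont (A s t) y"
proof -
  have "(C * (t - s) powr \<alpha>)-lipschitz_on UNIV (A s t)"
    using germ_lipschitz[OF assms] C_nonneg by (intro lipschitz_onI) (auto simp: dist_norm)
  then show ?thesis
    using lipschitz_on_continuous_on continuous_on_eq_continuous_at[OF open_UNIV] by blast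
qed

lemma lowered_exponent:
  assumes "0 \<le> x" "x \<le> d" "0 \<le> K"
  shows "K * x powr \<theta> \<le> (K * d powr (\<theta> - \<theta>')) * x powr \<theta>'"
proof -
  have "x powr \<theta> = x powr (\<theta> - \<theta>') * x powr \<theta>'"
    by (simp flip: powr_add)
  also have "\<dots> \<le> d powr (\<theta> - \<theta>') * x powr \<theta>'"
    using assms exponent_between by (intro mult_right_mono powr_mono2) auto
  finally show ?thesis using assms(3) by (simp add: mult_left_mono mult.assoc)
qed

text \<open>A scheme on a refinement, viewed on the coarse grid, has one-step errors of order
  \<theta>, while the coarse scheme has none. With the lowered exponent these errors carry the
  factor \<open>d powr (\<theta> - \<theta>')\<close>, which vanishes with the mesh, so stability
  makes the schemes a Cauchy family.\<close>

lemma local_existence: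
  obtains h K where "0 < h" "0 \<le> K"
    "\<And>a b y. \<lbrakk>0 \<le> a; a \<le> b; b \<le> T; b - a \<le> h\<rbrakk> \<Longrightarrow> \<exists>Y. Y a = y \<and> davie_path A \<theta> K a b Y"
proof -
  obtain h1 K where h1: "0 < h1" and K: "0 \<le> K" and bound:
    "\<And>a b P Y s t. \<lbrakk>0 \<le> a; b \<le> T; b - a \<le> h1; finite P; P \<subseteq> {a..b};
       \<And>s t. consecutive P s t \<Longrightarrow> deviation A Y s t = 0; s \<in> P; t \<in> P; s \<le> t\<rbrakk>
       \<Longrightarrow> norm (deviation A Y s t) \<le> K * (t - s) powr \<theta>"
    using euler_path_bound by blast
  obtain h2 where h2: "0 < h2" and stable:
    "\<And>a b P Y Z \<epsilon> t. \<lbrakk>0 \<le> a; b \<le> T; b - a \<le> h2; finite P; P \<subseteq> {a..b}; a \<in> P; Y a = Z a;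
       \<And>s t. \<lbrakk>s \<in> P; t \<in> P; s \<le> t\<rbrakk> \<Longrightarrow> norm (deviation A Z s t) \<le> K * (t - s) powr \<theta>;
       \<And>s t. consecutive P s t \<Longrightarrow>
         norm (deviation A Y s t - deviation A Z s t) \<le> \<epsilon> * (t - s) powr \<theta>';
       0 \<le> \<epsilon>; t \<in> P\<rbrakk> \<Longrightarrow> norm (Y t - Z t) \<le> \<epsilon>"
    using davie_path_stability[OF K] by metis
  show ?thesis
  proof (rule that[of "min h1 h2" K])
    show "0 < min h1 h2" "0 \<le> K" using h1 h2 K by auto
    fix a b :: real and y
    assume ab: "0 \<le> a" "a \<le> b" "b \<le> T" "b - a \<le> min h1 h2"
    \<comment> \<open>The values of a scheme off \<open>P\<close> are arbitrary; every later
      comparison is made at points of the grids involved.\<close>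
    define eul where "eul P = (SOME Y. Y a = y \<and> (\<forall>s t. consecutive P s t \<longrightarrow> deviation A Y s t = 0))"
      for P
    have eul: "eul P a = y" "\<And>s t. consecutive P s t \<Longrightarrow> deviation A (eul P) s t = 0"
      if "fine_grid a b d P" for P d
    proof -
      have "eul P a = y \<and> (\<forall>s t. consecutive P s t \<longrightarrow> deviation A (eul P) s t = 0)"
        unfolding eul_def using fine_gridD[OF that]
        by (intro someI_ex[OF euler_path_ex]) auto
      then show "eul P a = y" "\<And>s t. consecutive P s t \<Longrightarrow> deviation A (eul P) s t = 0" by auto
    qed
    have eulK: "norm (deviation A (eul P) s t) \<le> K * (t - s) powr \<theta>"
      if "fine_grid a b d P" "s \<in> P" "t \<in> P" "s \<le> t" for P d s t
      using bound[of a b P "eul P" s t] fine_gridD[OF that(1)] eul(2)[OF that(1)] that ab by auto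
    define \<omega> where "\<omega> d = K * d powr (\<theta> - \<theta>')" for d
    have \<omega>0: "0 \<le> \<omega> d" for d using K by (simp add: \<omega>_def)
    have refine: "norm (eul Q t - eul P t) \<le> \<omega> d"
      if P: "fine_grid a b d P" and Q: "fine_grid a b d Q" and "P \<subseteq> Q" "t \<in> P" for P Q d t
    proof (rule stable[of a b P "eul Q" "eul P" "\<omega> d" t])
      show "norm (deviation A (eul P) s t) \<le> K * (t - s) powr \<theta>" if "s \<in> P" "t \<in> P" "s \<le> t" for s t
        using eulK[OF P that] .
      fix s t assume c: "consecutive P s t"
      then have "norm (deviation A (eul Q) s t) \<le> K * (t - s) powr \<theta>"
        using eulK[OF Q, of s t] \<open>P \<subseteq> Q\<close> consecutiveD[OF c] by auto
      also have "\<dots> \<le> \<omega> d * (t - s) powr \<theta>'"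
        unfolding \<omega>_def using lowered_exponent[of "t - s" d K] fine_gridD(4)[OF P c] consecutiveD[OF c] K
        by auto
      finally show "norm (deviation A (eul Q) s t - deviation A (eul P) s t) \<le> \<omega> d * (t - s) powr \<theta>'"
        using eul(2)[OF P c] by simp
    qed (use ab fine_gridD[OF P] eul(1)[OF P] eul(1)[OF Q] \<omega>0 that in auto)
    \<comment> \<open>Two unrelated grids are compared through the scheme on their union.\<close>
    have compare: "norm (eul P t - eul Q t) \<le> 2 * \<omega> d"
      if P: "fine_grid a b d P" and Q: "fine_grid a b d Q" and t: "t \<in> P" "t \<in> Q" for P Q d t
    proof -
      have "fine_grid a b d (P \<union> Q)"
        using fine_grid_superset[OF P, of "P \<union> Q"] fine_gridD[OF P] fine_gridD[OF Q] by auto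
      then have "norm (eul (P \<union> Q) t - eul P t) \<le> \<omega> d" "norm (eul (P \<union> Q) t - eul Q t) \<le> \<omega> d"
        using refine P Q t by auto
      then show ?thesis by norm
    qed
    define dd where "dd n = 1 / real (Suc n)" for n
    have dd: "0 < dd n" "n \<le> m \<Longrightarrow> dd m \<le> dd n" for n m by (auto simp: dd_def divide_simps)
    have "dd \<longlonglongrightarrow> 0" unfolding dd_def by (rule LIMSEQ_Suc[OF lim_1_over_n])
    then have "(\<lambda>n. K * dd n powr (\<theta> - \<theta>')) \<longlonglongrightarrow> K * 0"
      using exponent_between dd(1)
      by (intro tendsto_mult tendsto_const tendsto_zero_powrI) (auto simp: less_imp_le)
    then have \<omega>lim: "(\<lambda>n. 2 * \<omega> (dd n)) \<longlonglongrightarrow> 0"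
      unfolding \<omega>_def using tendsto_mult_left[of _ 0 sequentially 2] by simp
    have "\<forall>n. \<exists>P. fine_grid a b (dd n) P" using fine_grid_ex ab dd by blast
    then obtain G where G: "\<And>n. fine_grid a b (dd n) (G n)" by metis
    have Gins: "fine_grid a b (dd n) (insert s (insert t (G n)))" if "s \<in> {a..b}" "t \<in> {a..b}" for n s t
      using fine_grid_superset[OF G[of n], of "insert s (insert t (G n))"] fine_gridD[OF G[of n]] that
      by auto
    \<comment> \<open>Inserting \<open>t\<close> into the grid makes the limit available at every
      time directly, without extending it from a dense set.\<close>
    define w where "w n t = eul (insert t (G n)) t" for n t
    define Y where "Y t = lim (\<lambda>n. w n t)" for t
    have lim: "(\<lambda>n. w n t) \<longlonglongrightarrow> Y t" if t: "t \<in> {a..b}" for t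
    proof -
      have "Cauchy (\<lambda>n. w n t)"
      proof (rule CauchyI)
        fix e :: real assume "0 < e"
        then have "\<forall>\<^sub>F n in sequentially. 2 * \<omega> (dd n) < e" using order_tendstoD(2)[OF \<omega>lim] by blast
        then obtain N where N: "2 * \<omega> (dd N) < e" by (auto simp: eventually_sequentially)
        have "norm (w m t - w n t) < e" if "N \<le> m" "N \<le> n" for m n
        proof -
          have "fine_grid a b (dd N) (insert t (G m))" "fine_grid a b (dd N) (insert t (G n))"
            using Gins[OF t t] dd(2) that by (auto intro: fine_grid_mono)
          then have "norm (w m t - w n t) \<le> 2 * \<omega> (dd N)" unfolding w_def by (intro compare) auto
          then show ?thesis using N by simp
        qed
        then show "\<exists>M. \<forall>m\<ge>M. \<forall>n\<ge>M. norm (w m t - w n t) < e" by blast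
      qed
      then show ?thesis unfolding Y_def by (simp add: Cauchy_convergent_iff convergent_LIMSEQ_iff)
    qed
    have "Y a = y"
    proof -
      have "w n a = y" for n unfolding w_def using eul(1) Gins[of a a n] ab by auto
      then show ?thesis using lim[of a] ab by (simp add: LIMSEQ_const_iff)
    qed
    moreover have "davie_path A \<theta> K a b Y"
      unfolding davie_path_def
    proof (intro allI impI)
      fix s t assume st: "a \<le> s \<and> s \<le> t \<and> t \<le> b"
      then have mem: "s \<in> {a..b}" "t \<in> {a..b}" by auto
      \<comment> \<open>Davie's estimate for a pair \<open>s\<close>, \<open>t\<close> needs one
        scheme whose grid contains both times. It has the same limits there as the schemes defining
        \<open>Y\<close>, and continuity of the germ lets the estimate pass to the limit.\<close>
      define v where "v n = eul (insert s (insert t (G n)))" for n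
      have vlim: "(\<lambda>n. v n r) \<longlonglongrightarrow> Y r" if r: "r = s \<or> r = t" for r
      proof (rule Lim_transform2)
        show "(\<lambda>n. w n r) \<longlonglongrightarrow> Y r" using lim mem r by auto
        have "norm (w n r - v n r) \<le> 2 * \<omega> (dd n)" for n
          unfolding w_def v_def using Gins[of r r n] Gins[OF mem, of n] mem r by (intro compare) auto
        then show "(\<lambda>n. w n r - v n r) \<longlonglongrightarrow> 0"
          by (intro Lim_null_comparison[OF _ \<omega>lim] always_eventually) blast
      qed
      have "(\<lambda>n. norm (deviation A (v n) s t)) \<longlonglongrightarrow> norm (deviation A Y s t)"
        unfolding deviation_def using st ab
        by (intro tendsto_intros vlim isCont_tendsto_compose[OF germ_continuous]) auto
      moreover have "norm (deviation A (v n) s t) \<le> K * (t - s) powr \<theta>" for n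
        unfolding v_def using eulK[OF Gins[OF mem]] st by auto
      ultimately show "norm (deviation A Y s t) \<le> K * (t - s) powr \<theta>"
        by (intro LIMSEQ_le_const2) auto
    qed
    ultimately show "\<exists>Y. Y a = y \<and> davie_path A \<theta> K a b Y" by blast
  qed
qed

text \<open>An interval across the junction \<open>b\<close> is split there by
  \<open>deviation_subadditive\<close>. The constant grows with each gluing, but only finitely many
  pieces occur and their length does not depend on it.\<close>

lemma davie_path_glue:
  assumes Y: "davie_path A \<theta> K a b Y" and Z: "davie_path A \<theta> L b c Z" and eq: "Y b = Z b"
    and ab: "0 \<le> a" "a \<le> b" "b \<le> c" "c \<le> T" and pos: "0 \<le> K" "0 \<le> L"
  shows "davie_path A \<theta> ((1 + C * T powr \<alpha>) * K + L + C) a c (\<lambda>t. if t \<le> b then Y t else Z t)"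
    (is "davie_path A \<theta> ?M a c ?W")
  unfolding davie_path_def
proof (intro allI impI)
  fix s t assume st: "a \<le> s \<and> s \<le> t \<and> t \<le> c"
  have CT: "0 \<le> C * T powr \<alpha>" using C_nonneg by simp
  have M: "K \<le> ?M" "L \<le> ?M" using CT pos C_nonneg by (auto simp: algebra_simps)
  show "norm (deviation A ?W s t) \<le> ?M * (t - s) powr \<theta>"
  proof (cases "t \<le> b \<or> b < s")
    case True
    then have "norm (deviation A ?W s t) \<le> max K L * (t - s) powr \<theta>"
    proof
      assume "t \<le> b"
      then have "norm (deviation A ?W s t) \<le> K * (t - s) powr \<theta>"
        using davie_pathD[OF Y, of s t] st by (auto simp: deviation_def)
      also have "\<dots> \<le> max K L * (t - s) powr \<theta>" by (intro mult_right_mono) auto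
      finally show ?thesis .
    next
      assume "b < s"
      then have "norm (deviation A ?W s t) \<le> L * (t - s) powr \<theta>"
        using davie_pathD[OF Z, of s t] st by (auto simp: deviation_def)
      also have "\<dots> \<le> max K L * (t - s) powr \<theta>" by (intro mult_right_mono) auto
      finally show ?thesis .
    qed
    also have "\<dots> \<le> ?M * (t - s) powr \<theta>" using M by (intro mult_right_mono) auto
    finally show ?thesis .
  next
    case False
    have mono: "x powr \<theta> \<le> (t - s) powr \<theta>" if "0 \<le> x" "x \<le> t - s" for x
      using that exponents by (intro powr_mono2) auto
    have "norm (deviation A ?W s b) \<le> K * (b - s) powr \<theta>"
      using davie_pathD[OF Y, of s b] st False by (auto simp: deviation_def)
    also have "\<dots> \<le> K * (t - s) powr \<theta>" using False st pos by (intro mult_left_mono mono) auto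
    finally have 1: "norm (deviation A ?W s b) \<le> K * (t - s) powr \<theta>" .
    have "norm (deviation A ?W b t) \<le> L * (t - b) powr \<theta>"
      using davie_pathD[OF Z, of b t] st False eq by (auto simp: deviation_def)
    also have "\<dots> \<le> L * (t - s) powr \<theta>" using False st pos by (intro mult_left_mono mono) auto
    finally have 2: "norm (deviation A ?W b t) \<le> L * (t - s) powr \<theta>" .
    have "C * (t - b) powr \<alpha> \<le> C * T powr \<alpha>"
      using False st ab C_nonneg exponents by (intro mult_left_mono powr_mono2) auto
    then have "(1 + C * (t - b) powr \<alpha>) * norm (deviation A ?W s b)
        \<le> (1 + C * T powr \<alpha>) * (K * (t - s) powr \<theta>)"
      using 1 CT by (intro mult_mono) auto
    then show ?thesis
      using deviation_subadditive[of s b t ?W] 2 False st ab by (simp add: algebra_simps)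
  qed
qed

theorem global_existence:
  assumes "0 \<le> T"
  shows "\<exists>Y K. Y 0 = y \<and> 0 \<le> K \<and> davie_path A \<theta> K 0 T Y"
proof -
  obtain h K where h: "0 < h" and K: "0 \<le> K" and loc:
    "\<And>a b y. \<lbrakk>0 \<le> a; a \<le> b; b \<le> T; b - a \<le> h\<rbrakk> \<Longrightarrow> \<exists>Y. Y a = y \<and> davie_path A \<theta> K a b Y"
    using local_existence by blast
  have "\<exists>Y L. Y 0 = y \<and> 0 \<le> L \<and> davie_path A \<theta> L 0 (min T (real n * h)) Y" for n
  proof (induction n)
    case 0
    then show ?case using loc[of 0 0 y] assms h K by auto
  next
    case (Suc n)
    define b where "b = min T (real n * h)"
    define c where "c = min T (real (Suc n) * h)"
    have bc: "0 \<le> b" "b \<le> c" "c \<le> T" "c - b \<le> h" using h assms by (auto simp: b_def c_def min_def algebra_simps)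
    from Suc obtain Y L where Y: "Y 0 = y" "0 \<le> L" "davie_path A \<theta> L 0 b Y" by (auto simp: b_def)
    obtain Z where Z: "Z b = Y b" "davie_path A \<theta> K b c Z" using loc[of b c "Y b"] bc by auto
    have "davie_path A \<theta> ((1 + C * T powr \<alpha>) * L + K + C) 0 c (\<lambda>t. if t \<le> b then Y t else Z t)"
      using davie_path_glue[OF Y(3) Z(2)] Z(1) bc Y K by auto
    moreover have "0 \<le> (1 + C * T powr \<alpha>) * L + K + C" using C_nonneg Y K by simp
    ultimately show ?case using Y(1) bc unfolding c_def[symmetric]
      by (intro exI[of _ "\<lambda>t. if t \<le> b then Y t else Z t"] exI) auto
  qed
  moreover obtain n :: nat where "T / h \<le> real n" using real_arch_simple by blast
  then have "min T (real n * h) = T" using h by (simp add: field_simps min_def)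
  ultimately show ?thesis by metis
qed

text \<open>On a grid of mesh \<open>d\<close> the one-step errors of both paths are of order
  \<theta>, hence small multiples of the lowered power. Stability bounds the distance of the paths
  by a quantity that vanishes with \<open>d\<close>.\<close>

theorem uniqueness:
  assumes Y: "davie_path A \<theta> K 0 T Y" and Z: "davie_path A \<theta> L 0 T Z" and "Y 0 = Z 0"
    and t: "0 \<le> t" "t \<le> T"
  shows "Y t = Z t"
proof -
  \<comment> \<open>One nonnegative constant for both paths; the signs of \<open>K\<close> and
    \<open>L\<close> are not prescribed.\<close>
  define M where "M = max 0 (max K L)"
  have M: "0 \<le> M" "davie_path A \<theta> M 0 T Y" "davie_path A \<theta> M 0 T Z"
    using davie_path_mono[OF Y, of M] davie_path_mono[OF Z, of M] by (auto simp: M_def)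
  obtain h where h: "0 < h" and stable:
    "\<And>a b P Y Z \<epsilon> t. \<lbrakk>0 \<le> a; b \<le> T; b - a \<le> h; finite P; P \<subseteq> {a..b}; a \<in> P; Y a = Z a;
       \<And>s t. \<lbrakk>s \<in> P; t \<in> P; s \<le> t\<rbrakk> \<Longrightarrow> norm (deviation A Z s t) \<le> M * (t - s) powr \<theta>;
       \<And>s t. consecutive P s t \<Longrightarrow>
         norm (deviation A Y s t - deviation A Z s t) \<le> \<epsilon> * (t - s) powr \<theta>';
       0 \<le> \<epsilon>; t \<in> P\<rbrakk> \<Longrightarrow> norm (Y t - Z t) \<le> \<epsilon>"
    using davie_path_stability[OF M(1)] by metis
  have step: "Y t = Z t" if ab: "0 \<le> a" "b \<le> T" "b - a \<le> h" and "Y a = Z a" and t: "a \<le> t" "t \<le> b" for a b t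
  proof -
    have "norm (Y t - Z t) \<le> e" if "0 < e" for e
    proof -
      obtain d where d: "0 < d" "2 * M * d powr (\<theta> - \<theta>') \<le> e"
        using small_powr_ex[of "2 * M" e "\<theta> - \<theta>'"] M(1) \<open>0 < e\<close> exponent_between
        by (metis diff_gt_0_iff_gt mult_nonneg_nonneg order_less_imp_le order_refl zero_le_numeral)
      obtain P0 where P0: "fine_grid a b d P0" using fine_grid_ex[of a b d] t d by auto
      define P where "P = insert t P0"
      have P: "fine_grid a b d P"
        unfolding P_def using fine_grid_superset[OF P0, of "insert t P0"] fine_gridD[OF P0] t by auto
      have PT: "s \<in> P \<Longrightarrow> 0 \<le> s \<and> s \<le> T" for s using fine_gridD(2)[OF P] ab by force
      have "norm (Y t - Z t) \<le> 2 * M * d powr (\<theta> - \<theta>')"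
      proof (rule stable[of a b P Y Z _ t])
        show "norm (deviation A Z s t) \<le> M * (t - s) powr \<theta>" if "s \<in> P" "t \<in> P" "s \<le> t" for s t
          using davie_pathD[OF M(3)] PT that by blast
        fix s t assume c: "consecutive P s t"
        have st: "0 \<le> s" "s \<le> t" "t \<le> T" using PT consecutiveD[OF c] by auto
        have "norm (deviation A Y s t - deviation A Z s t) \<le> 2 * M * (t - s) powr \<theta>"
          using davie_pathD[OF M(2) st] davie_pathD[OF M(3) st]
            norm_triangle_ineq4[of "deviation A Y s t" "deviation A Z s t"] by linarith
        also have "\<dots> \<le> 2 * M * d powr (\<theta> - \<theta>') * (t - s) powr \<theta>'"
          using lowered_exponent[of "t - s" d "2 * M"] fine_gridD(4)[OF P c] st M(1) by auto
        finally show "norm (deviation A Y s t - deviation A Z s t)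
            \<le> 2 * M * d powr (\<theta> - \<theta>') * (t - s) powr \<theta>'" .
      qed (use ab fine_gridD[OF P] that \<open>Y a = Z a\<close> M(1) in \<open>auto simp: P_def\<close>)
      then show ?thesis using d by simp
    qed
    then have "norm (Y t - Z t) \<le> 0" by (rule field_le_epsilon[of _ 0, simplified])
    then show ?thesis by simp
  qed
  have "\<forall>t. 0 \<le> t \<and> t \<le> min T (real n * h) \<longrightarrow> Y t = Z t" for n
  proof (induction n)
    case 0
    then show ?case using \<open>Y 0 = Z 0\<close> by auto
  next
    case (Suc n)
    show ?case
    proof (intro allI impI)
      fix t assume t: "0 \<le> t \<and> t \<le> min T (real (Suc n) * h)"
      show "Y t = Z t"
      proof (cases "t \<le> real n * h")
        case True
        then show ?thesis using Suc t by auto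
      next
        case False
        have n0: "0 \<le> real n * h" using h by simp
        with False t Suc have "Y (real n * h) = Z (real n * h)" by auto
        then show ?thesis using step[of "real n * h" t t] False t n0 by (auto simp: algebra_simps)
      qed
    qed
  qed
  moreover obtain n :: nat where "T / h \<le> real n" using real_arch_simple by blast
  then have "min T (real n * h) = T" using h by (simp add: field_simps min_def)
  ultimately show ?thesis using t by metis
qed

end

section \<open>Bounded Lipschitz maps and Taylor remainders\<close>

text \<open>A single constant serves both bounds, so that one computation yields the size of the
  defect and its Lipschitz constant in the state.\<close>

definition bounded_lipschitz :: "real \<Rightarrow> ('a::real_normed_vector \<Rightarrow> 'b::real_normed_vector) \<Rightarrow> bool" where
  "bounded_lipschitz c f \<longleftrightarrow>
     (\<forall>y. norm (f y) \<le> c) \<and> (\<forall>y z. norm (f y - f z) \<le> c * norm (y - z))"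

text \<open>What remains of a bounded and Lipschitz derivative of \<open>f\<close> when only values of \<open>f\<close> may be used.\<close>

definition four_point_bounded :: "real \<Rightarrow> ('a::real_normed_vector \<Rightarrow> 'b::real_normed_vector) \<Rightarrow> bool" where
  "four_point_bounded c f \<longleftrightarrow>
     (\<forall>y z r q. norm ((f (y + r) - f y) - (f (z + q) - f z))
        \<le> c * (norm (r - q) + norm q * norm (y - z)))"

lemma bounded_lipschitzD:
  assumes "bounded_lipschitz c f"
  shows "norm (f y) \<le> c" "norm (f y - f z) \<le> c * norm (y - z)" "0 \<le> c"
  using assms order_trans[OF norm_ge_zero] unfolding bounded_lipschitz_def by blast+

lemma four_point_boundedD:
  assumes "four_point_bounded c f"
  shows "norm ((f (y + r) - f y) - (f (z + q) - f z)) \<le> c * (norm (r - q) + norm q * norm (y - z))"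
  using assms unfolding four_point_bounded_def by blast

lemma bounded_lipschitz_mono:
  assumes "bounded_lipschitz c f" "c \<le> d"
  shows "bounded_lipschitz d f"
  using assms unfolding bounded_lipschitz_def by (meson mult_right_mono norm_ge_zero order_trans)

lemma four_point_bounded_mono:
  assumes "four_point_bounded c f" "c \<le> d"
  shows "four_point_bounded d f"
  using assms unfolding four_point_bounded_def
  by (meson mult_right_mono norm_ge_zero order_trans add_nonneg_nonneg mult_nonneg_nonneg)

lemma bounded_lipschitz_add:
  assumes "bounded_lipschitz c f" "bounded_lipschitz d g"
  shows "bounded_lipschitz (c + d) (\<lambda>y. f y + g y)"
  unfolding bounded_lipschitz_def
proof safe
  fix y z
  show "norm (f y + g y) \<le> c + d"
    using bounded_lipschitzD(1)[OF assms(1), of y] bounded_lipschitzD(1)[OF assms(2), of y] by norm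
  show "norm (f y + g y - (f z + g z)) \<le> (c + d) * norm (y - z)"
    unfolding distrib_right
    using bounded_lipschitzD(2)[OF assms(1), of y z] bounded_lipschitzD(2)[OF assms(2), of y z]
      norm_triangle_ineq[of "f y - f z" "g y - g z"] by (simp add: algebra_simps)
qed

lemma bounded_lipschitz_minus:
  "bounded_lipschitz c f \<Longrightarrow> bounded_lipschitz c (\<lambda>y. - f y)"
  unfolding bounded_lipschitz_def by (simp add: norm_minus_commute)

lemma bounded_lipschitz_diff:
  assumes "bounded_lipschitz c f" "bounded_lipschitz d g"
  shows "bounded_lipschitz (c + d) (\<lambda>y. f y - g y)"
  using bounded_lipschitz_add[OF assms(1) bounded_lipschitz_minus[OF assms(2)]] by simp

lemma bounded_lipschitz_linear:
  assumes f: "bounded_lipschitz c f" and L: "linear L" "\<And>v. norm (L v) \<le> k * norm v" and k: "0 \<le> k"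
  shows "bounded_lipschitz (k * c) (\<lambda>y. L (f y))"
  unfolding bounded_lipschitz_def
proof safe
  fix y z
  show "norm (L (f y)) \<le> k * c"
    using L(2)[of "f y"] mult_left_mono[OF bounded_lipschitzD(1)[OF f, of y] k] by linarith
  show "norm (L (f y) - L (f z)) \<le> k * c * norm (y - z)"
    using L(2)[of "f y - f z"] mult_left_mono[OF bounded_lipschitzD(2)[OF f, of y z] k]
    by (simp add: linear_diff[OF L(1)] mult.assoc)
qed

lemma four_point_bounded_linear:
  assumes f: "four_point_bounded c f" and L: "linear L" "\<And>v. norm (L v) \<le> k * norm v" and k: "0 \<le> k"
  shows "four_point_bounded (k * c) (\<lambda>y. L (f y))"
  unfolding four_point_bounded_def
proof safe
  fix y z r q
  let ?v = "(f (y + r) - f y) - (f (z + q) - f z)"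
  have "norm (L ?v) \<le> k * (c * (norm (r - q) + norm q * norm (y - z)))"
    using L(2)[of ?v] mult_left_mono[OF four_point_boundedD[OF f, of y r z q] k] by linarith
  then show "norm ((L (f (y + r)) - L (f y)) - (L (f (z + q)) - L (f z)))
      \<le> k * c * (norm (r - q) + norm q * norm (y - z))"
    by (simp add: linear_diff[OF L(1)] mult.assoc)
qed

lemma four_point_bounded_add:
  assumes "four_point_bounded c f" "four_point_bounded d g"
  shows "four_point_bounded (c + d) (\<lambda>y. f y + g y)"
  unfolding four_point_bounded_def
proof safe
  fix y z r q
  show "norm ((f (y + r) + g (y + r) - (f y + g y)) - (f (z + q) + g (z + q) - (f z + g z)))
      \<le> (c + d) * (norm (r - q) + norm q * norm (y - z))"
    unfolding distrib_right[of c d]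
    using four_point_boundedD[OF assms(1), of y r z q] four_point_boundedD[OF assms(2), of y r z q]
      norm_triangle_ineq[of "(f (y + r) - f y) - (f (z + q) - f z)" "(g (y + r) - g y) - (g (z + q) - g z)"]
    by (simp add: algebra_simps)
qed

lemma bounded_lipschitz_prod:
  fixes f :: "'a::real_normed_vector \<Rightarrow> 'b::real_normed_vector"
    and g :: "'a \<Rightarrow> 'c::real_normed_vector"
    and pr :: "'b \<Rightarrow> 'c \<Rightarrow> 'd::real_normed_vector"
  assumes bb: "bounded_bilinear pr" and pr: "\<And>a b. norm (pr a b) \<le> norm a * norm b"
    and f: "bounded_lipschitz c f" and g: "bounded_lipschitz d g"
  shows "bounded_lipschitz (2 * (c * d)) (\<lambda>y. pr (f y) (g y))"
  unfolding bounded_lipschitz_def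
proof safe
  interpret bounded_bilinear pr by (rule bb)
  note f' = bounded_lipschitzD[OF f] note g' = bounded_lipschitzD[OF g]
  fix y z
  have "norm (pr (f y) (g y)) \<le> norm (f y) * norm (g y)" by (rule pr)
  also have "\<dots> \<le> c * d" using f' g' by (intro mult_mono) auto
  finally show "norm (pr (f y) (g y)) \<le> 2 * (c * d)" using mult_nonneg_nonneg[OF f'(3) g'(3)] by linarith
  have "pr (f y) (g y) - pr (f z) (g z) = pr (f y - f z) (g y) + pr (f z) (g y - g z)"
    by (simp add: diff_left diff_right)
  then have "norm (pr (f y) (g y) - pr (f z) (g z))
      \<le> norm (f y - f z) * norm (g y) + norm (f z) * norm (g y - g z)"
    by (metis norm_triangle_mono[OF pr pr])
  also have "\<dots> \<le> (c * norm (y - z)) * d + c * (d * norm (y - z))"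
    using f' g' by (intro add_mono mult_mono) auto
  finally show "norm (pr (f y) (g y) - pr (f z) (g z)) \<le> 2 * (c * d) * norm (y - z)"
    by (simp add: algebra_simps)
qed

text \<open>The second difference of a product consists of two terms with a second difference of one
  factor, \<open>a1\<close> and \<open>a3\<close>, and two with first differences of both,
  \<open>a2\<close> and \<open>a4\<close>. The term \<open>a2\<close> counts twice, hence the
  5.\<close>

lemma four_point_bounded_prod:
  fixes f :: "'a::real_normed_vector \<Rightarrow> 'b::real_normed_vector"
    and g :: "'a \<Rightarrow> 'c::real_normed_vector"
    and pr :: "'b \<Rightarrow> 'c \<Rightarrow> 'd::real_normed_vector"
  assumes bb: "bounded_bilinear pr" and pr: "\<And>a b. norm (pr a b) \<le> norm a * norm b"
    and f: "bounded_lipschitz c f" "four_point_bounded c f"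
    and g: "bounded_lipschitz d g" "four_point_bounded d g"
  shows "four_point_bounded (5 * (c * d)) (\<lambda>y. pr (f y) (g y))"
  unfolding four_point_bounded_def
proof safe
  interpret bounded_bilinear pr by (rule bb)
  note f' = bounded_lipschitzD[OF f(1)] note g' = bounded_lipschitzD[OF g(1)]
  fix y z r q :: 'a
  define R where "R = norm (r - q) + norm q * norm (y - z)"
  have cd: "0 \<le> c * d" using f' g' by simp
  define a1 where "a1 = pr ((f (y + r) - f y) - (f (z + q) - f z)) (g (y + r))"
  define a2 where "a2 = pr (f (z + q) - f z) (g (y + r) - g (z + q))"
  define a3 where "a3 = pr (f y) ((g (y + r) - g y) - (g (z + q) - g z))"
  define a4 where "a4 = pr (f y - f z) (g (z + q) - g z)"
  have eq: "(pr (f (y + r)) (g (y + r)) - pr (f y) (g y))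
      - (pr (f (z + q)) (g (z + q)) - pr (f z) (g z)) = a1 + a2 + a3 + a4"
    unfolding a1_def a2_def a3_def a4_def diff_left diff_right by simp
  have "norm a1 \<le> norm ((f (y + r) - f y) - (f (z + q) - f z)) * norm (g (y + r))"
    unfolding a1_def by (rule pr)
  also have "\<dots> \<le> (c * R) * d"
    unfolding R_def using four_point_boundedD[OF f(2)] f' g' by (intro mult_mono) auto
  finally have 1: "norm a1 \<le> c * d * R" by (simp add: mult_ac)
  have "norm a3 \<le> norm (f y) * norm ((g (y + r) - g y) - (g (z + q) - g z))"
    unfolding a3_def by (rule pr)
  also have "\<dots> \<le> c * (d * R)"
    unfolding R_def using four_point_boundedD[OF g(2)] f' g' by (intro mult_mono) auto
  finally have 3: "norm a3 \<le> c * d * R" by (simp add: mult_ac)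
  have fq: "norm (f (z + q) - f z) \<le> c * norm q" using f'(2)[of "z + q" z] by simp
  have gq: "norm (g (z + q) - g z) \<le> d * norm q" using g'(2)[of "z + q" z] by simp
  have "norm a4 \<le> norm (f y - f z) * norm (g (z + q) - g z)" unfolding a4_def by (rule pr)
  also have "\<dots> \<le> (c * norm (y - z)) * (d * norm q)" using f' g' gq by (intro mult_mono) auto
  also have "\<dots> \<le> c * d * R"
    using mult_nonneg_nonneg[OF cd norm_ge_zero[of "r - q"]] by (simp add: R_def algebra_simps)
  finally have 4: "norm a4 \<le> c * d * R" .
  have f2: "norm (f (z + q) - f z) \<le> 2 * c"
    using f'(1)[of "z + q"] f'(1)[of z] norm_triangle_ineq4[of "f (z + q)" "f z"] by linarith
  have "norm (g (y + r) - g (z + q)) \<le> d * norm ((y - z) + (r - q))"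
    using g'(2)[of "y + r" "z + q"] by (simp add: algebra_simps)
  also have "\<dots> \<le> d * (norm (y - z) + norm (r - q))"
    using g'(3) by (intro mult_left_mono norm_triangle_ineq)
  finally have g2: "norm (g (y + r) - g (z + q)) \<le> d * norm (y - z) + d * norm (r - q)"
    by (simp add: distrib_left)
  have "norm a2 \<le> norm (f (z + q) - f z) * norm (g (y + r) - g (z + q))" unfolding a2_def by (rule pr)
  also have "\<dots> \<le> norm (f (z + q) - f z) * (d * norm (y - z) + d * norm (r - q))"
    by (intro mult_left_mono g2) auto
  \<comment> \<open>The increment of \<open>f\<close> is bounded by \<open>c * norm q\<close>
    against \<open>norm (y - z)\<close>, but by \<open>2 * c\<close> against
    \<open>norm (r - q)\<close>; each choice produces a term of the four-point bound.\<close>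
  also have "\<dots> \<le> (c * norm q) * (d * norm (y - z)) + (2 * c) * (d * norm (r - q))"
    unfolding distrib_left using f2 fq g' f' by (intro add_mono mult_right_mono) auto
  also have "\<dots> \<le> 2 * (c * d * R)"
    using mult_nonneg_nonneg[OF cd, of "norm q * norm (y - z)"]
      mult_nonneg_nonneg[OF cd norm_ge_zero[of "r - q"]] by (simp add: R_def algebra_simps)
  finally have 2: "norm a2 \<le> 2 * (c * d * R)" .
  have "norm (a1 + a2 + a3 + a4) \<le> norm a1 + norm a2 + norm a3 + norm a4"
    using norm_triangle_ineq[of "a1 + a2 + a3" a4] norm_triangle_ineq[of "a1 + a2" a3]
      norm_triangle_ineq[of a1 a2] by linarith
  also have "\<dots> \<le> 5 * (c * d * R)" using 1 2 3 4 by linarith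
  finally have "norm (a1 + a2 + a3 + a4) \<le> 5 * (c * d) * R" by (simp only: mult.assoc)
  then show "norm ((pr (f (y + r)) (g (y + r)) - pr (f y) (g y))
      - (pr (f (z + q)) (g (z + q)) - pr (f z) (g z)))
      \<le> 5 * (c * d) * (norm (r - q) + norm q * norm (y - z))"
    unfolding eq R_def[symmetric] .
qed

text \<open>A small bounded Lipschitz displacement \<open>a\<close> makes the increment of
  \<open>f\<close> equally small, including its Lipschitz constant. Both the displacement and the
  base point vary with \<open>y\<close>, which is why a Lipschitz bound on \<open>f\<close> would
  not suffice.\<close>

lemma bounded_lipschitz_shift:
  assumes f: "four_point_bounded c f" and a: "bounded_lipschitz k a" and c: "0 \<le> c"
  shows "bounded_lipschitz (2 * (c * k)) (\<lambda>y. f (y + a y) - f y)"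
  unfolding bounded_lipschitz_def
proof safe
  note a' = bounded_lipschitzD[OF a]
  fix y z
  have "norm (f (y + a y) - f y) \<le> c * norm (a y)"
    using four_point_boundedD[OF f, of y "a y" y 0] by simp
  also have "\<dots> \<le> c * k" using a' c by (intro mult_left_mono) auto
  finally show "norm (f (y + a y) - f y) \<le> 2 * (c * k)" using mult_nonneg_nonneg[OF c a'(3)] by linarith
  have "norm ((f (y + a y) - f y) - (f (z + a z) - f z))
      \<le> c * (norm (a y - a z) + norm (a z) * norm (y - z))"
    by (rule four_point_boundedD[OF f])
  also have "\<dots> \<le> c * (k * norm (y - z) + k * norm (y - z))"
    using a' c by (intro mult_left_mono add_mono mult_right_mono) auto
  finally show "norm (f (y + a y) - f y - (f (z + a z) - f z)) \<le> 2 * (c * k) * norm (y - z)"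
    by (simp add: algebra_simps)
qed

text \<open>The Lipschitz estimate in \<open>y\<close> of the Taylor remainder \<open>R y a\<close> is obtained by differentiating
  \<open>R y \<xi> - R z \<xi>\<close> in \<open>\<xi>\<close>, which avoids the symmetry of the second derivative.\<close>

lemma bounded_lipschitz_taylor:
  fixes f :: "'a::real_normed_vector \<Rightarrow> 'b::real_normed_vector"
  assumes der: "\<And>x. (f has_derivative blinfun_apply (D x)) (at x)"
    and D: "bounded_lipschitz c D" "four_point_bounded c D" and a: "bounded_lipschitz k a"
  shows "bounded_lipschitz (2 * c * k\<^sup>2) (\<lambda>y. f (y + a y) - f y - blinfun_apply (D y) (a y))"
proof -
  note a' = bounded_lipschitzD[OF a] note D' = bounded_lipschitzD[OF D(1)]
  have der': "((\<lambda>\<xi>. f (y + \<xi>) - blinfun_apply (D y) \<xi>) has_derivative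
      blinfun_apply (D (y + \<xi>) - D y)) (at \<xi> within S)" for y \<xi> S
  proof -
    have "((\<lambda>\<xi>. f (y + \<xi>)) has_derivative blinfun_apply (D (y + \<xi>))) (at \<xi> within S)"
      by (rule has_derivative_compose[OF _ der]) (auto intro!: derivative_eq_intros)
    then show ?thesis
      by (auto intro!: derivative_eq_intros simp: blinfun.diff_left)
  qed
  have R1: "norm (f (y + u) - f (y + v) - blinfun_apply (D y) (u - v)) \<le> c * k * norm (u - v)"
    if "norm u \<le> k" "norm v \<le> k" for y u v
  proof -
    have "norm ((f (y + u) - blinfun_apply (D y) u) - (f (y + v) - blinfun_apply (D y) v))
        \<le> c * k * norm (u - v)"
    proof (rule differentiable_bound[OF convex_cball[of 0 k] der'])
      fix \<xi> assume "\<xi> \<in> cball (0::'a) k"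
      then have "c * norm \<xi> \<le> c * k" using D' by (intro mult_left_mono) auto
      then show "onorm (blinfun_apply (D (y + \<xi>) - D y)) \<le> c * k"
        using D'(2)[of "y + \<xi>" y] by (simp add: norm_blinfun.rep_eq)
    qed (use that in auto)
    then show ?thesis by (simp add: blinfun.diff_right algebra_simps)
  qed
  have R2: "norm ((f (y + v) - f y - blinfun_apply (D y) v) - (f (z + v) - f z - blinfun_apply (D z) v))
      \<le> c * k * k * norm (y - z)" if "norm v \<le> k" for y z v
  proof -
    have "norm (((f (y + v) - blinfun_apply (D y) v) - (f (z + v) - blinfun_apply (D z) v))
        - ((f (y + 0) - blinfun_apply (D y) 0) - (f (z + 0) - blinfun_apply (D z) 0)))
      \<le> (c * (k * norm (y - z))) * norm (v - 0)"
    proof (rule differentiable_bound[OF convex_cball[of 0 k] has_derivative_diff[OF der' der']])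
      fix \<xi> assume "\<xi> \<in> cball (0::'a) k"
      then have "c * (norm \<xi> * norm (y - z)) \<le> c * (k * norm (y - z))"
        using D' by (intro mult_left_mono mult_right_mono) auto
      then have "norm ((D (y + \<xi>) - D y) - (D (z + \<xi>) - D z)) \<le> c * (k * norm (y - z))"
        using four_point_boundedD[OF D(2), of y \<xi> z \<xi>] by simp
      moreover have "(\<lambda>h. blinfun_apply (D (y + \<xi>) - D y) h - blinfun_apply (D (z + \<xi>) - D z) h)
          = blinfun_apply ((D (y + \<xi>) - D y) - (D (z + \<xi>) - D z))"
        by (auto simp: blinfun.diff_left)
      ultimately show "onorm (\<lambda>h. blinfun_apply (D (y + \<xi>) - D y) h - blinfun_apply (D (z + \<xi>) - D z) h)
          \<le> c * (k * norm (y - z))" by (simp add: norm_blinfun.rep_eq)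
    qed (use that a' in auto)
    also have "\<dots> \<le> (c * (k * norm (y - z))) * k" using that a' D' by (intro mult_left_mono) auto
    finally show ?thesis by (simp add: blinfun.zero_right algebra_simps)
  qed
  show ?thesis
    unfolding bounded_lipschitz_def
  proof safe
    fix y z
    have ck: "0 \<le> c * k" using a' D' by simp
    have "norm (f (y + a y) - f (y + 0) - blinfun_apply (D y) (a y - 0)) \<le> c * k * norm (a y - 0)"
      using a' by (intro R1) auto
    also have "\<dots> \<le> c * k * k" using a' ck by (intro mult_left_mono) auto
    finally show "norm (f (y + a y) - f y - blinfun_apply (D y) (a y)) \<le> 2 * c * k\<^sup>2"
      using mult_nonneg_nonneg[OF ck a'(3)] by (simp add: power2_eq_square flip: mult.assoc)
    have "norm (f (y + a y) - f (y + a z) - blinfun_apply (D y) (a y - a z)) \<le> c * k * norm (a y - a z)"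
      using a' by (intro R1) auto
    also have "\<dots> \<le> c * k * (k * norm (y - z))" using a' ck by (intro mult_left_mono) auto
    finally have 1: "norm (f (y + a y) - f (y + a z) - blinfun_apply (D y) (a y - a z))
        \<le> c * k * k * norm (y - z)" by (simp add: mult.assoc)
    have 2: "norm ((f (y + a z) - f y - blinfun_apply (D y) (a z)) - (f (z + a z) - f z - blinfun_apply (D z) (a z)))
        \<le> c * k * k * norm (y - z)" using a' by (intro R2) auto
    \<comment> \<open>First the increment changes from \<open>a y\<close> to \<open>a z\<close> at
      the fixed base point \<open>y\<close>, then the base point changes at the fixed increment
      \<open>a z\<close>.\<close>
    have eq: "f (y + a y) - f y - blinfun_apply (D y) (a y) - (f (z + a z) - f z - blinfun_apply (D z) (a z))
      = (f (y + a y) - f (y + a z) - blinfun_apply (D y) (a y - a z))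
        + ((f (y + a z) - f y - blinfun_apply (D y) (a z)) - (f (z + a z) - f z - blinfun_apply (D z) (a z)))"
      by (simp add: blinfun.diff_right)
    show "norm (f (y + a y) - f y - blinfun_apply (D y) (a y) - (f (z + a z) - f z - blinfun_apply (D z) (a z)))
        \<le> 2 * c * k\<^sup>2 * norm (y - z)"
      unfolding eq using norm_triangle_mono[OF 1 2] by (simp add: power2_eq_square mult_ac)
  qed
qed

section \<open>Difference bounds from bounded derivatives\<close>

lemma has_derivative_frechet_map:
  assumes "f differentiable (at x)"
  shows "(f has_derivative blinfun_apply (frechet_map f x)) (at x)"
proof -
  have "(f has_derivative frechet_derivative f (at x)) (at x)"
    using assms frechet_derivative_works by blast
  then show ?thesis
    using has_derivative_bounded_linear[of f] by (simp add: frechet_map_def bounded_linear_Blinfun_apply)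
qed

lemma lipschitz_derivative_bound:
  assumes "\<And>x. (f has_derivative blinfun_apply (D x)) (at x)" "\<And>x. norm (D x) \<le> c"
  shows "norm (f y - f z) \<le> c * norm (y - z)"
  using differentiable_bound[of UNIV f "\<lambda>x. blinfun_apply (D x)" c y z] assms
  by (simp add: norm_blinfun.rep_eq)

text \<open>For the common increment \<open>q\<close>, the map
  \<open>y \<mapsto> f (y + q) - f y\<close> has derivative \<open>D (y + q) - D y\<close>, of size
  \<open>c * norm q\<close>; this moves the base point. Replacing \<open>q\<close> by
  \<open>r\<close> then costs one ordinary Lipschitz estimate.\<close>

lemma four_point_bounded_derivative:
  fixes f :: "'a::real_normed_vector \<Rightarrow> 'b::real_normed_vector"
  assumes der: "\<And>x. (f has_derivative blinfun_apply (D x)) (at x)" and D: "bounded_lipschitz c D"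
  shows "four_point_bounded c f"
  unfolding four_point_bounded_def
proof safe
  note D' = bounded_lipschitzD[OF D]
  fix y z r q
  have "((\<lambda>y. f (y + q) - f y) has_derivative blinfun_apply (D (x + q) - D x)) (at x)" for x
  proof -
    have "((\<lambda>y. f (y + q)) has_derivative blinfun_apply (D (x + q))) (at x)"
      by (rule has_derivative_compose[OF _ der]) (auto intro!: derivative_eq_intros)
    then show ?thesis using der[of x] by (auto intro!: derivative_eq_intros simp: blinfun.diff_left)
  qed
  moreover have "norm (D (x + q) - D x) \<le> c * norm q" for x using D'(2)[of "x + q" x] by simp
  ultimately have 1: "norm ((f (y + q) - f y) - (f (z + q) - f z)) \<le> (c * norm q) * norm (y - z)"
    by (rule lipschitz_derivative_bound)
  have 2: "norm (f (y + r) - f (y + q)) \<le> c * norm (r - q)"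
    using lipschitz_derivative_bound[OF der D'(1), of "y + r" "y + q"] by simp
  have eq: "f (y + r) - f y - (f (z + q) - f z)
      = (f (y + r) - f (y + q)) + ((f (y + q) - f y) - (f (z + q) - f z))" by simp
  show "norm (f (y + r) - f y - (f (z + q) - f z)) \<le> c * (norm (r - q) + norm q * norm (y - z))"
    unfolding eq using norm_triangle_mono[OF 2 1] by (simp add: algebra_simps)
qed

text \<open>Each property descends one order: the bound on the third derivative makes the second one
  Lipschitz, and this gives the four-point bound for the first.\<close>

lemma C3b_bounds:
  assumes "C3b F"
  obtains c where "\<And>x. (F has_derivative blinfun_apply (frechet_map F x)) (at x)"
    "bounded_lipschitz c F" "four_point_bounded c F"
    "bounded_lipschitz c (frechet_map F)" "four_point_bounded c (frechet_map F)"
proof -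
  let ?D = "frechet_map F" let ?D2 = "frechet_map ?D" let ?D3 = "frechet_map ?D2"
  obtain b0 b1 b2 b3 where b: "\<And>x. norm (F x) \<le> b0" "\<And>x. norm (?D x) \<le> b1"
    "\<And>x. norm (?D2 x) \<le> b2" "\<And>x. norm (?D3 x) \<le> b3"
    using assms unfolding C3b_def bounded_iff by (metis rangeI)
  define c where "c = max (max b0 b1) (max b2 b3)"
  have b': "norm (F x) \<le> c" "norm (?D x) \<le> c" "norm (?D2 x) \<le> c" "norm (?D3 x) \<le> c" for x
    using b by (auto simp: c_def le_max_iff_disj)
  have der: "(F has_derivative blinfun_apply (?D x)) (at x)"
    "(?D has_derivative blinfun_apply (?D2 x)) (at x)"
    "(?D2 has_derivative blinfun_apply (?D3 x)) (at x)" for x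
    using assms by (auto simp: C3b_def intro!: has_derivative_frechet_map)
  have bl: "bounded_lipschitz c F" "bounded_lipschitz c ?D" "bounded_lipschitz c ?D2"
    unfolding bounded_lipschitz_def
    using b' lipschitz_derivative_bound[OF der(1) b'(2)] lipschitz_derivative_bound[OF der(2) b'(3)]
      lipschitz_derivative_bound[OF der(3) b'(4)] by auto
  show ?thesis
    using that[OF der(1) bl(1) _ bl(2)] four_point_bounded_derivative[OF der(1) bl(2)]
      four_point_bounded_derivative[OF der(2) bl(3)] by blast
qed

section \<open>Extension of bilinear maps to the projective tensor product\<close>

lemma bilinear_comp_linear:
  assumes "bilinear b" "linear f"
  shows "bilinear (\<lambda>x y. f (b x y))"
proof -
  have b: "linear (\<lambda>y. b x y)" "linear (\<lambda>x. b x y)" for x y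
    using assms(1) by (simp_all add: bilinear_def)
  show ?thesis
    unfolding bilinear_def
    using linear_compose[OF b(1) assms(2)] linear_compose[OF b(2) assms(2)] by (simp add: o_def)
qed

lemma tensor_sum_append: "tensor_sum t (ps @ qs) = tensor_sum t ps + tensor_sum t qs"
  by (simp add: tensor_sum_def)

lemma tensor_sum_scale:
  assumes "bilinear t"
  shows "tensor_sum t (map (\<lambda>(x, y). (c *\<^sub>R x, y)) ps) = c *\<^sub>R tensor_sum t ps"
  by (induction ps) (auto simp: tensor_sum_def bilinear_lmul[OF assms] scaleR_add_right)

lemma tensor_sum_linear:
  assumes "linear f"
  shows "tensor_sum (\<lambda>x y. f (b x y)) ps = f (tensor_sum b ps)"
  by (induction ps) (auto simp: tensor_sum_def linear_add[OF assms] linear_0[OF assms])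

text \<open>Vector-valued bilinear maps are reduced to bilinear forms by algebraic linear functionals,
  so that Hahn-Banach is not needed.\<close>

lemma tensor_sum_eq_zero:
  assumes t: "projective_tensor t" "tensor_sum t ps = 0"
    and b: "bilinear (b :: _ \<Rightarrow> _ \<Rightarrow> 'd::real_vector)"
  shows "tensor_sum b ps = 0"
proof (rule ccontr)
  assume nz: "tensor_sum b ps \<noteq> 0"
  then have "independent {tensor_sum b ps}" by simp
  then obtain f :: "'d \<Rightarrow> real" where f: "linear f" "f (tensor_sum b ps) = 1"
    using linear_independent_extend[of "{tensor_sum b ps}" "\<lambda>_. 1 :: real"] by auto
  have "tensor_sum (\<lambda>x y. f (b x y)) ps = 0"
    using t bilinear_comp_linear[OF b f(1)] unfolding projective_tensor_def by blast
  then show False using f tensor_sum_linear[OF f(1), of b ps] by simp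
qed

lemma tensor_sum_cong:
  fixes t :: "'a::real_normed_vector \<Rightarrow> 'b::real_normed_vector \<Rightarrow> 'c::banach"
  assumes t: "projective_tensor t" and b: "bilinear (b :: _ \<Rightarrow> _ \<Rightarrow> 'd::real_vector)"
    and eq: "tensor_sum t ps = tensor_sum t qs"
  shows "tensor_sum b ps = tensor_sum b qs"
proof -
  have bt: "bilinear t" using t by (simp add: projective_tensor_def)
  let ?r = "ps @ map (\<lambda>(x, y). ((-1) *\<^sub>R x, y)) qs"
  have "tensor_sum t ?r = 0" unfolding tensor_sum_append tensor_sum_scale[OF bt] eq by simp
  then have "tensor_sum b ?r = 0" by (rule tensor_sum_eq_zero[OF t _ b])
  then show ?thesis unfolding tensor_sum_append tensor_sum_scale[OF b] by simp
qed

text \<open>The triangle inequality bounds the left side through any representation of the same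
  tensor, and the projective norm is the infimum over all of them. The case \<open>B = 0\<close> is
  separate because the infimum is compared after division by \<open>B\<close>.\<close>

lemma norm_tensor_sum_le:
  assumes t: "projective_tensor t" and b: "bilinear (b :: _ \<Rightarrow> _ \<Rightarrow> 'd::real_normed_vector)"
    and bound: "\<And>x y. norm (b x y) \<le> B * (norm x * norm y)" and B: "0 \<le> B"
  shows "norm (tensor_sum b ps) \<le> B * norm (tensor_sum t ps)"
proof -
  have le: "norm (tensor_sum b qs) \<le> B * (\<Sum>(x, y)\<leftarrow>qs. norm x * norm y)" for qs
  proof (induction qs)
    case (Cons q qs)
    have "norm (tensor_sum b (q # qs)) \<le> norm (b (fst q) (snd q)) + norm (tensor_sum b qs)"
      by (simp add: tensor_sum_def case_prod_beta norm_triangle_ineq)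
    with Cons bound[of "fst q" "snd q"] show ?case by (simp add: case_prod_beta algebra_simps)
  qed (simp add: tensor_sum_def)
  let ?S = "{(\<Sum>(x, y)\<leftarrow>qs. norm x * norm y) | qs. tensor_sum t qs = tensor_sum t ps}"
  have S: "norm (tensor_sum b ps) \<le> B * \<sigma>" if "\<sigma> \<in> ?S" for \<sigma>
  proof -
    obtain qs where qs: "\<sigma> = (\<Sum>(x, y)\<leftarrow>qs. norm x * norm y)" "tensor_sum t qs = tensor_sum t ps"
      using \<open>\<sigma> \<in> ?S\<close> by blast
    then show ?thesis using le[of qs] tensor_sum_cong[OF t b qs(2)] by simp
  qed
  have ne: "?S \<noteq> {}" by blast
  have eq: "norm (tensor_sum t ps) = Inf ?S" using t unfolding projective_tensor_def by blast
  show ?thesis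
  proof (cases "B = 0")
    case True
    then show ?thesis using S ne by auto
  next
    case False
    have "norm (tensor_sum b ps) / B \<le> Inf ?S"
      using S False B by (intro cInf_greatest ne) (auto simp: field_simps)
    then show ?thesis using False B by (simp add: eq field_simps)
  qed
qed

lemma tensor_blinfun_unique:
  assumes t: "projective_tensor t"
    and eq: "\<And>x y. blinfun_apply L (t x y) = blinfun_apply M (t x y)"
  shows "L = M"
proof -
  have "blinfun_apply L (tensor_sum t ps) = blinfun_apply M (tensor_sum t ps)" for ps
    by (induction ps) (auto simp: tensor_sum_def blinfun.bilinear_simps eq)
  then have "range (tensor_sum t) \<subseteq> {c. blinfun_apply L c = blinfun_apply M c}" by auto
  moreover have "closed {c. blinfun_apply L c = blinfun_apply M c}"
    by (intro closed_Collect_eq) (auto intro!: continuous_intros)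
  ultimately have "closure (range (tensor_sum t)) \<subseteq> {c. blinfun_apply L c = blinfun_apply M c}"
    by (rule closure_minimal)
  then show ?thesis using t by (auto simp: projective_tensor_def intro!: blinfun_eqI)
qed

text \<open>On finite sums of elementary tensors the map does not depend on the representation and
  is \<open>B\<close>-Lipschitz, so it extends to the completion.\<close>

lemma tensor_blinfun_ex:
  fixes b :: "'a::real_normed_vector \<Rightarrow> 'b::real_normed_vector \<Rightarrow> 'd::banach"
  assumes t: "projective_tensor t" and b: "bilinear b"
    and bound: "\<And>x y. norm (b x y) \<le> B * (norm x * norm y)" and B: "0 \<le> B"
  shows "\<exists>L. (\<forall>x y. blinfun_apply L (t x y) = b x y) \<and> norm L \<le> B"
proof -
  have bt: "bilinear t" and dense: "closure (range (tensor_sum t)) = UNIV"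
    using t by (auto simp: projective_tensor_def)
  define f where "f c = tensor_sum b (SOME ps. tensor_sum t ps = c)" for c
  have f: "f (tensor_sum t ps) = tensor_sum b ps" for ps
    unfolding f_def by (rule tensor_sum_cong[OF t b]) (rule someI_ex, blast)
  have "B-lipschitz_on (range (tensor_sum t)) f"
  proof (rule lipschitz_onI[OF _ B], safe)
    fix ps qs :: "('a \<times> 'b) list"
    let ?r = "ps @ map (\<lambda>(x, y). ((-1) *\<^sub>R x, y)) qs"
    have "norm (tensor_sum b ?r) \<le> B * norm (tensor_sum t ?r)"
      by (rule norm_tensor_sum_le[OF t b bound B])
    then show "dist (f (tensor_sum t ps)) (f (tensor_sum t qs))
        \<le> B * dist (tensor_sum t ps) (tensor_sum t qs)"
      unfolding f tensor_sum_append tensor_sum_scale[OF bt] tensor_sum_scale[OF b]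
      by (simp add: dist_norm)
  qed
  \<comment> \<open>The extension is known only to be Lipschitz. Its linearity is recovered below by
    approximating with finite tensor sums.\<close>
  from lipschitz_extend_closure[OF this] obtain g
    where g: "B-lipschitz_on UNIV g" "\<And>ps. g (tensor_sum t ps) = tensor_sum b ps"
    unfolding dense using f by auto
  have cont: "isCont g c" for c
    using lipschitz_on_continuous_on[OF g(1)] continuous_on_eq_continuous_at[OF open_UNIV] by blast
  have approx: "\<exists>u. (\<lambda>n. tensor_sum t (u n)) \<longlonglongrightarrow> c" for c
  proof -
    have "c \<in> closure (range (tensor_sum t))" using dense by simp
    then obtain v where v: "\<And>n. v n \<in> range (tensor_sum t)" "v \<longlonglongrightarrow> c"
      unfolding closure_sequential by blast
    then have "\<forall>n. \<exists>p. v n = tensor_sum t p" by blast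
    then obtain u where "\<And>n. v n = tensor_sum t (u n)" by metis
    then have "v = (\<lambda>n. tensor_sum t (u n))" by auto
    then show ?thesis using v by auto
  qed
  have add: "g (c + d) = g c + g d" for c d
  proof -
    obtain u v where u: "(\<lambda>n. tensor_sum t (u n)) \<longlonglongrightarrow> c" and v: "(\<lambda>n. tensor_sum t (v n)) \<longlonglongrightarrow> d"
      using approx by meson
    have "(\<lambda>n. g (tensor_sum t (u n) + tensor_sum t (v n))) \<longlonglongrightarrow> g (c + d)"
      by (intro isCont_tendsto_compose[OF cont] tendsto_add u v)
    moreover have "(\<lambda>n. g (tensor_sum t (u n)) + g (tensor_sum t (v n))) \<longlonglongrightarrow> g c + g d"
      by (intro isCont_tendsto_compose[OF cont] tendsto_add u v)
    moreover have "g (tensor_sum t p + tensor_sum t q) = g (tensor_sum t p) + g (tensor_sum t q)" for p q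
      using g(2)[of "p @ q"] by (simp add: tensor_sum_append g(2))
    ultimately show ?thesis using LIMSEQ_unique by auto
  qed
  have scale: "g (r *\<^sub>R c) = r *\<^sub>R g c" for r c
  proof -
    obtain u where u: "(\<lambda>n. tensor_sum t (u n)) \<longlonglongrightarrow> c" using approx by meson
    have "(\<lambda>n. g (r *\<^sub>R tensor_sum t (u n))) \<longlonglongrightarrow> g (r *\<^sub>R c)"
      by (intro isCont_tendsto_compose[OF cont] tendsto_intros u)
    moreover have "(\<lambda>n. r *\<^sub>R g (tensor_sum t (u n))) \<longlonglongrightarrow> r *\<^sub>R g c"
      by (intro isCont_tendsto_compose[OF cont] tendsto_intros u)
    moreover have "g (r *\<^sub>R tensor_sum t p) = r *\<^sub>R g (tensor_sum t p)" for p
      by (metis bt b g(2) tensor_sum_scale)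
    ultimately show ?thesis using LIMSEQ_unique by auto
  qed
  have "g 0 = 0" using scale[of 0 0] by simp
  then have bd: "norm (g c) \<le> norm c * B" for c
    using lipschitz_onD[OF g(1), of c 0] by (simp add: dist_norm mult.commute)
  have bl: "bounded_linear g" by (rule bounded_linear_intro[OF add scale bd])
  have "norm (Blinfun g) \<le> B"
    using bd B bl by (intro norm_blinfun_bound) (auto simp: bounded_linear_Blinfun_apply mult.commute)
  moreover have "g (t x y) = b x y" for x y
    using g(2)[of "[(x, y)]"] by (simp add: tensor_sum_def)
  ultimately show ?thesis using bl by (intro exI[of _ "Blinfun g"]) (auto simp: bounded_linear_Blinfun_apply)
qed

text \<open>Existence and uniqueness give the \<open>THE\<close> in \<open>tensor_extension\<close>
  its meaning; all later facts about it go through here.\<close>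

lemma tensor_extension_apply_norm:
  fixes b :: "'a::real_normed_vector \<Rightarrow> 'b::real_normed_vector \<Rightarrow> 'd::banach"
  assumes t: "projective_tensor t" and b: "bilinear b"
    and bound: "\<And>x y. norm (b x y) \<le> B * (norm x * norm y)" and B: "0 \<le> B"
  shows "blinfun_apply (tensor_extension t b) (t x y) = b x y"
    and "norm (tensor_extension t b) \<le> B"
proof -
  obtain L where L: "\<And>x y. blinfun_apply L (t x y) = b x y" "norm L \<le> B"
    using tensor_blinfun_ex[OF assms] by blast
  have "tensor_extension t b = L"
    unfolding tensor_extension_def
  proof (rule the_equality)
    show "\<forall>x y. blinfun_apply L (t x y) = b x y" using L by simp
    show "M = L" if "\<forall>x y. blinfun_apply M (t x y) = b x y" for M
      using that L(1) by (intro tensor_blinfun_unique[OF t]) simp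
  qed
  then show "blinfun_apply (tensor_extension t b) (t x y) = b x y"
    and "norm (tensor_extension t b) \<le> B" using L by auto
qed

text \<open>With \<open>p = Z' u\<close> and \<open>m = DF(Y u) F(Y u)\<close> this is the
  second-order coefficient of the Riemann sums when \<open>Y' = F(Y) Z'\<close>. Separating
  \<open>m\<close>, which carries the state, from \<open>p\<close>, which carries the time, makes
  the term linear in \<open>m\<close>.\<close>

definition second_level ::
  "('v::real_normed_vector \<Rightarrow> 'v \<Rightarrow> 'vv::real_normed_vector) \<Rightarrow> ('v \<Rightarrow>\<^sub>L 'u::real_normed_vector) \<Rightarrow>
     ('u \<Rightarrow>\<^sub>L 'u \<Rightarrow>\<^sub>L 'w::real_normed_vector) \<Rightarrow> 'vv \<Rightarrow>\<^sub>L 'w" where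
  "second_level t p m =
     tensor_extension t (\<lambda>x y. blinfun_apply (blinfun_apply m (blinfun_apply p x)) (blinfun_apply p y))"

lemma bilinear_blinfun2:
  "bilinear (\<lambda>x y. blinfun_apply (blinfun_apply m (blinfun_apply p x)) (blinfun_apply q y))"
  unfolding bilinear_def by (intro conjI allI linearI) (simp_all add: blinfun.bilinear_simps)

lemma norm_blinfun2:
  "norm (blinfun_apply (blinfun_apply m a) b) \<le> norm m * norm a * norm b"
  by (rule order_trans[OF norm_blinfun mult_right_mono[OF norm_blinfun norm_ge_zero]])

lemma norm_blinfun2_le:
  "norm (blinfun_apply (blinfun_apply m (blinfun_apply p x)) (blinfun_apply q y))
     \<le> (norm m * norm p * norm q) * (norm x * norm y)"
proof -
  have "norm (blinfun_apply (blinfun_apply m (blinfun_apply p x)) (blinfun_apply q y))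
      \<le> norm m * norm (blinfun_apply p x) * norm (blinfun_apply q y)" by (rule norm_blinfun2)
  also have "\<dots> \<le> norm m * (norm p * norm x) * (norm q * norm y)"
    by (intro mult_mono norm_blinfun) auto
  finally show ?thesis by (simp add: mult_ac)
qed

context
  fixes t :: "'v::real_normed_vector \<Rightarrow> 'v \<Rightarrow> 'vv::banach"
  assumes t: "projective_tensor t"
begin

text \<open>The two slots have separate maps \<open>p\<close> and \<open>q\<close>, since a
  difference of second-level terms, quadratic in \<open>p\<close>, has \<open>p - q\<close> in only
  one slot.\<close>

lemma tensor_extension_blinfun2:
  fixes m :: "'u::real_normed_vector \<Rightarrow>\<^sub>L 'u \<Rightarrow>\<^sub>L 'w::banach"
  defines "b p q \<equiv> \<lambda>x y. blinfun_apply (blinfun_apply m (blinfun_apply p x)) (blinfun_apply q y)"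
  shows "blinfun_apply (tensor_extension t (b p q)) (t x y) = b p q x y"
    and "norm (tensor_extension t (b p q)) \<le> norm m * norm p * norm q"
proof -
  have 1: "bilinear (b p q)" unfolding b_def by (rule bilinear_blinfun2)
  have 2: "norm (b p q x y) \<le> (norm m * norm p * norm q) * (norm x * norm y)" for x y
    unfolding b_def by (rule norm_blinfun2_le)
  have 3: "0 \<le> norm m * norm p * norm q" by simp
  show "blinfun_apply (tensor_extension t (b p q)) (t x y) = b p q x y"
    and "norm (tensor_extension t (b p q)) \<le> norm m * norm p * norm q"
    using tensor_extension_apply_norm[OF t 1 2 3] by auto
qed

lemma second_level_tensor:
  fixes m :: "'u::real_normed_vector \<Rightarrow>\<^sub>L 'u \<Rightarrow>\<^sub>L 'w::banach"
  shows "blinfun_apply (second_level t p m) (t x y) =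
    blinfun_apply (blinfun_apply m (blinfun_apply p x)) (blinfun_apply p y)"
  unfolding second_level_def by (rule tensor_extension_blinfun2)

lemma norm_second_level:
  fixes m :: "'u::real_normed_vector \<Rightarrow>\<^sub>L 'u \<Rightarrow>\<^sub>L 'w::banach"
  shows "norm (second_level t p m) \<le> norm m * norm p * norm p"
  unfolding second_level_def by (rule tensor_extension_blinfun2)

lemma second_level_add:
  fixes m :: "'u::real_normed_vector \<Rightarrow>\<^sub>L 'u \<Rightarrow>\<^sub>L 'w::banach"
  shows "second_level t p (m + n) = second_level t p m + second_level t p n"
  by (rule tensor_blinfun_unique[OF t]) (simp add: blinfun.bilinear_simps second_level_tensor)

lemma second_level_scale:
  fixes m :: "'u::real_normed_vector \<Rightarrow>\<^sub>L 'u \<Rightarrow>\<^sub>L 'w::banach"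
  shows "second_level t p (r *\<^sub>R m) = r *\<^sub>R second_level t p m"
  by (rule tensor_blinfun_unique[OF t]) (simp add: blinfun.bilinear_simps second_level_tensor)

lemma second_level_diff_bound:
  fixes m :: "'u::real_normed_vector \<Rightarrow>\<^sub>L 'u \<Rightarrow>\<^sub>L 'w::banach"
  shows "norm (second_level t p m - second_level t q m) \<le> norm m * norm (p - q) * (norm p + norm q)"
proof -
  define E1 where "E1 = tensor_extension t (\<lambda>x y. blinfun_apply (blinfun_apply m (blinfun_apply (p - q) x)) (blinfun_apply p y))"
  define E2 where "E2 = tensor_extension t (\<lambda>x y. blinfun_apply (blinfun_apply m (blinfun_apply q x)) (blinfun_apply (p - q) y))"
  note E1 = tensor_extension_blinfun2[of m "p - q" p, folded E1_def]
  note E2 = tensor_extension_blinfun2[of m q "p - q", folded E2_def]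
  have "second_level t p m - second_level t q m = E1 + E2"
  proof (rule tensor_blinfun_unique[OF t])
    show "blinfun_apply (second_level t p m - second_level t q m) (t x y) = blinfun_apply (E1 + E2) (t x y)" for x y
      unfolding blinfun.diff_left blinfun.add_left second_level_tensor E1(1) E2(1) blinfun.diff_right by simp
  qed
  then have "norm (second_level t p m - second_level t q m) \<le> norm E1 + norm E2"
    by (simp add: norm_triangle_ineq)
  also have "\<dots> \<le> norm m * norm (p - q) * norm p + norm m * norm q * norm (p - q)"
    by (rule add_mono[OF E1(2) E2(2)])
  finally show ?thesis by (simp add: algebra_simps)
qed

end

section \<open>The germ of a rough differential equation\<close>

lemma powr_multiples:
  fixes x \<alpha> :: real
  shows "x powr (2 * \<alpha>) = (x powr \<alpha>)\<^sup>2" "x powr (3 * \<alpha>) = (x powr \<alpha>) ^ 3"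
proof -
  have "2 * \<alpha> = \<alpha> + \<alpha>" "3 * \<alpha> = \<alpha> + \<alpha> + \<alpha>" by auto
  then show "x powr (2 * \<alpha>) = (x powr \<alpha>)\<^sup>2" "x powr (3 * \<alpha>) = (x powr \<alpha>) ^ 3"
    by (simp_all only: powr_add power2_eq_square power3_eq_cube)
qed

text \<open>All data are bounded by one constant \<open>K\<close>, so that every later constant is a
  polynomial in \<open>K\<close> and \<open>T powr \<alpha>\<close>. Squares of
  \<open>(t - s) powr \<alpha>\<close> stand for the exponent \<open>2 * \<alpha>\<close>, which
  lets orders be counted as powers of one quantity.\<close>

locale rough_equation =
  fixes tens :: "'v::banach \<Rightarrow> 'v \<Rightarrow> 'vv::banach"
    and \<alpha> T :: real
    and X :: "real \<Rightarrow> real \<Rightarrow> 'v"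
    and XX :: "real \<Rightarrow> real \<Rightarrow> 'vv"
    and Z :: "real \<Rightarrow> 'u::banach"
    and Z' :: "real \<Rightarrow> 'v \<Rightarrow>\<^sub>L 'u"
    and F :: "'w::banach \<Rightarrow> 'u \<Rightarrow>\<^sub>L 'w"
    and K :: real
  assumes tens: "projective_tensor tens" and \<alpha>: "1 / 3 < \<alpha>" and T: "0 < T" and K: "0 \<le> K"
    and chen_XX: "\<lbrakk>0 \<le> s; s \<le> u; u \<le> t; t \<le> T\<rbrakk> \<Longrightarrow>
      XX s t = XX s u + XX u t + tens (X s u) (X u t)"
    and X_le: "\<lbrakk>0 \<le> s; s \<le> t; t \<le> T\<rbrakk> \<Longrightarrow> norm (X s t) \<le> K * (t - s) powr \<alpha>"
    and XX_le: "\<lbrakk>0 \<le> s; s \<le> t; t \<le> T\<rbrakk> \<Longrightarrow> norm (XX s t) \<le> K * ((t - s) powr \<alpha>)\<^sup>2"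
    and Z_le: "\<lbrakk>0 \<le> s; s \<le> t; t \<le> T\<rbrakk> \<Longrightarrow> norm (Z t - Z s) \<le> K * (t - s) powr \<alpha>"
    and Z_remainder_le: "\<lbrakk>0 \<le> s; s \<le> t; t \<le> T\<rbrakk> \<Longrightarrow>
      norm (Z t - Z s - blinfun_apply (Z' s) (X s t)) \<le> K * ((t - s) powr \<alpha>)\<^sup>2"
    and Z'_le: "\<lbrakk>0 \<le> s; s \<le> T\<rbrakk> \<Longrightarrow> norm (Z' s) \<le> K"
    and Z'_diff_le: "\<lbrakk>0 \<le> s; s \<le> t; t \<le> T\<rbrakk> \<Longrightarrow> norm (Z' t - Z' s) \<le> K * (t - s) powr \<alpha>"
    and F_derivative: "\<And>x. (F has_derivative blinfun_apply (frechet_map F x)) (at x)"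
    and F_bl: "bounded_lipschitz K F" and F_fp: "four_point_bounded K F"
    and D_bl: "bounded_lipschitz K (frechet_map F)" and D_fp: "four_point_bounded K (frechet_map F)"
begin

definition vector_field_derivative :: "'w \<Rightarrow> 'u \<Rightarrow>\<^sub>L 'u \<Rightarrow>\<^sub>L 'w" where
  "vector_field_derivative y = frechet_map F y o\<^sub>L F y"

definition germ :: "real \<Rightarrow> real \<Rightarrow> 'w \<Rightarrow> 'w" where
  "germ s t y = blinfun_apply (F y) (Z t - Z s) +
     blinfun_apply (second_level tens (Z' s) (vector_field_derivative y)) (XX s t)"

lemma vector_field_derivative_regular:
  "bounded_lipschitz (5 * K\<^sup>2) vector_field_derivative"
  "four_point_bounded (5 * K\<^sup>2) vector_field_derivative"
proof -
  have "bounded_lipschitz (2 * (K * K)) (\<lambda>y. frechet_map F y o\<^sub>L F y)"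
    by (rule bounded_lipschitz_prod[OF bounded_bilinear_blinfun_compose norm_blinfun_compose D_bl F_bl])
  then show "bounded_lipschitz (5 * K\<^sup>2) vector_field_derivative"
    unfolding vector_field_derivative_def[abs_def]
    by (rule bounded_lipschitz_mono) (simp add: power2_eq_square)
  have "four_point_bounded (5 * (K * K)) (\<lambda>y. frechet_map F y o\<^sub>L F y)"
    by (rule four_point_bounded_prod[OF bounded_bilinear_blinfun_compose norm_blinfun_compose
        D_bl D_fp F_bl F_fp])
  then show "four_point_bounded (5 * K\<^sup>2) vector_field_derivative"
    unfolding vector_field_derivative_def[abs_def] by (simp add: power2_eq_square)
qed

lemma linear_second_level: "linear (\<lambda>m :: 'u \<Rightarrow>\<^sub>L 'u \<Rightarrow>\<^sub>L 'w. blinfun_apply (second_level tens p m) v)"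
  by (rule linearI) (simp_all add: second_level_add[OF tens] second_level_scale[OF tens] blinfun.bilinear_simps)

lemma second_level_le:
  fixes m :: "'u \<Rightarrow>\<^sub>L 'u \<Rightarrow>\<^sub>L 'w"
  assumes "norm p \<le> k" "norm v \<le> l"
  shows "norm (blinfun_apply (second_level tens p m) v) \<le> (k\<^sup>2 * l) * norm m"
proof -
  have k: "0 \<le> k" using assms norm_ge_zero order_trans by blast
  have "norm (blinfun_apply (second_level tens p m) v) \<le> norm (second_level tens p m) * norm v"
    by (rule norm_blinfun)
  also have "\<dots> \<le> (norm m * norm p * norm p) * norm v"
    by (intro mult_right_mono norm_second_level[OF tens]) auto
  also have "\<dots> \<le> (norm m * k * k) * l"
    using assms k by (intro mult_mono) auto
  finally show ?thesis by (simp add: power2_eq_square mult_ac)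
qed

lemma linear_eval: "linear (\<lambda>f. blinfun_apply f v)"
  by (rule linearI) (simp_all add: blinfun.bilinear_simps)

lemma eval_le: "norm v \<le> k \<Longrightarrow> norm (blinfun_apply f v) \<le> k * norm f"
  using norm_blinfun[of f v] mult_left_mono[of "norm v" k "norm f"] by (simp add: mult.commute)

lemma powr_le_T: "0 \<le> s \<Longrightarrow> s \<le> t \<Longrightarrow> t \<le> T \<Longrightarrow> (t - s) powr \<alpha> \<le> T powr \<alpha>"
  using \<alpha> by (intro powr_mono2) auto

text \<open>The first summand comes from \<open>F\<close> against the increment of \<open>Z\<close>.
  The second comes from the second-level term, whose surplus factor
  \<open>(t - s) powr \<alpha>\<close> is traded for \<open>T powr \<alpha>\<close>;
  \<open>5 * K\<^sup>2\<close> bounds \<open>vector_field_derivative\<close>.\<close>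

definition C1 :: real where "C1 = K\<^sup>2 + K\<^sup>2 * K * T powr \<alpha> * (5 * K\<^sup>2)"

definition C3 :: real where "C3 = K\<^sup>2 + K\<^sup>2 * K * (5 * K\<^sup>2)"

lemma C13_nonneg: "0 \<le> C1" "0 \<le> C3"
  using K by (auto simp: C1_def C3_def)

lemma germ_regular:
  assumes st: "0 \<le> s" "s \<le> t" "t \<le> T"
  shows "bounded_lipschitz (C1 * (t - s) powr \<alpha>) (germ s t)"
    and "four_point_bounded (C1 * (t - s) powr \<alpha>) (germ s t)"
proof -
  define \<rho> where "\<rho> = (t - s) powr \<alpha>"
  have \<rho>: "0 \<le> \<rho>" "\<rho> \<le> T powr \<alpha>" using st powr_le_T by (auto simp: \<rho>_def)
  have Z: "norm (Z t - Z s) \<le> K * \<rho>" using Z_le st by (simp add: \<rho>_def)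
  have XX: "norm (XX s t) \<le> K * \<rho>\<^sup>2" using XX_le st by (simp add: \<rho>_def)
  have Z': "norm (Z' s) \<le> K" using Z'_le st by simp
  have nn: "0 \<le> K * \<rho>" "0 \<le> K\<^sup>2 * (K * \<rho>\<^sup>2)" using K \<rho> by auto
  have "K\<^sup>2 * (K * \<rho>\<^sup>2) * (5 * K\<^sup>2) \<le> K\<^sup>2 * (K * (T powr \<alpha> * \<rho>)) * (5 * K\<^sup>2)"
    unfolding power2_eq_square[of \<rho>] using \<rho> K
    by (intro mult_right_mono mult_left_mono) auto
  then have c: "K * \<rho> * K + K\<^sup>2 * (K * \<rho>\<^sup>2) * (5 * K\<^sup>2) \<le> C1 * \<rho>"
    unfolding C1_def by (simp add: algebra_simps power2_eq_square)
  have g: "germ s t = (\<lambda>y. blinfun_apply (F y) (Z t - Z s) +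
     blinfun_apply (second_level tens (Z' s) (vector_field_derivative y)) (XX s t))"
    by (simp add: germ_def fun_eq_iff)
  show "bounded_lipschitz (C1 * (t - s) powr \<alpha>) (germ s t)"
    unfolding \<rho>_def[symmetric] g
    by (rule bounded_lipschitz_mono[OF bounded_lipschitz_add[OF
          bounded_lipschitz_linear[OF F_bl linear_eval eval_le[OF Z] nn(1)]
          bounded_lipschitz_linear[OF vector_field_derivative_regular(1) linear_second_level
            second_level_le[OF Z' XX] nn(2)]] c])
  show "four_point_bounded (C1 * (t - s) powr \<alpha>) (germ s t)"
    unfolding \<rho>_def[symmetric] g
    by (rule four_point_bounded_mono[OF four_point_bounded_add[OF
          four_point_bounded_linear[OF F_fp linear_eval eval_le[OF Z] nn(1)]
          four_point_bounded_linear[OF vector_field_derivative_regular(2) linear_second_level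
            second_level_le[OF Z' XX] nn(2)]] c])
qed

text \<open>Without the linear term \<open>F y (Z' s (X s t))\<close>, only the remainder of
  \<open>Z\<close> and the second-level term are left, both of order
  \<open>2 * \<alpha>\<close>.\<close>

lemma germ_first_order:
  assumes st: "0 \<le> s" "s \<le> t" "t \<le> T"
  shows "bounded_lipschitz (C3 * ((t - s) powr \<alpha>)\<^sup>2)
    (\<lambda>y. germ s t y - blinfun_apply (F y) (blinfun_apply (Z' s) (X s t)))"
proof -
  define \<rho> where "\<rho> = (t - s) powr \<alpha>"
  have Z: "norm (Z t - Z s - blinfun_apply (Z' s) (X s t)) \<le> K * \<rho>\<^sup>2"
    using Z_remainder_le st by (simp add: \<rho>_def)
  have XX: "norm (XX s t) \<le> K * \<rho>\<^sup>2" using XX_le st by (simp add: \<rho>_def)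
  have Z': "norm (Z' s) \<le> K" using Z'_le st by simp
  have nn: "0 \<le> K * \<rho>\<^sup>2" "0 \<le> K\<^sup>2 * (K * \<rho>\<^sup>2)" using K by auto
  have c: "K * \<rho>\<^sup>2 * K + K\<^sup>2 * (K * \<rho>\<^sup>2) * (5 * K\<^sup>2) = C3 * \<rho>\<^sup>2"
    unfolding C3_def by (simp add: algebra_simps power2_eq_square)
  have g: "(\<lambda>y. germ s t y - blinfun_apply (F y) (blinfun_apply (Z' s) (X s t))) =
    (\<lambda>y. blinfun_apply (F y) (Z t - Z s - blinfun_apply (Z' s) (X s t)) +
     blinfun_apply (second_level tens (Z' s) (vector_field_derivative y)) (XX s t))"
    by (simp add: germ_def fun_eq_iff blinfun.diff_right)
  show ?thesis
    unfolding \<rho>_def[symmetric] g c[symmetric]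
    by (rule bounded_lipschitz_add[OF
          bounded_lipschitz_linear[OF F_bl linear_eval eval_le[OF Z] nn(1)]
          bounded_lipschitz_linear[OF vector_field_derivative_regular(1) linear_second_level
            second_level_le[OF Z' XX] nn(2)]])
qed

text \<open>Chen's relation contributes \<open>M y x (Z' s (X u t))\<close>, and expanding
  \<open>F\<close> along the first step contributes \<open>M y x (Z t - Z u)\<close>; the two cancel
  up to a controlled remainder. What is left are five errors: the change of \<open>Z'\<close> from
  \<open>s\<close> to \<open>u\<close>, this remainder, the change of \<open>M\<close> along the
  step, the Taylor remainder of \<open>F\<close>, and the first-order error of the step
  \<open>a\<close>. Each is of order \<open>3 * \<alpha>\<close>.\<close>

lemma germ_defect_decomposition:
  assumes "0 \<le> s" "s \<le> u" "u \<le> t" "t \<le> T"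
  defines "M \<equiv> vector_field_derivative" and "a \<equiv> germ s u" and "x \<equiv> blinfun_apply (Z' s) (X s u)"
  shows "germ_defect germ s u t y =
      (blinfun_apply (second_level tens (Z' s) (M y)) (XX u t)
        - blinfun_apply (second_level tens (Z' u) (M y)) (XX u t))
      + blinfun_apply (blinfun_apply (M y) x) (blinfun_apply (Z' s) (X u t) - (Z t - Z u))
      - blinfun_apply (second_level tens (Z' u) (M (y + a y) - M y)) (XX u t)
      - blinfun_apply (F (y + a y) - F y - blinfun_apply (frechet_map F y) (a y)) (Z t - Z u)
      - blinfun_apply (blinfun_apply (frechet_map F y) (a y - blinfun_apply (F y) x)) (Z t - Z u)"
proof -
  have XX: "blinfun_apply (second_level tens (Z' s) (M y)) (XX s t) =
      blinfun_apply (second_level tens (Z' s) (M y)) (XX s u)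
      + blinfun_apply (second_level tens (Z' s) (M y)) (XX u t)
      + blinfun_apply (blinfun_apply (M y) x) (blinfun_apply (Z' s) (X u t))"
    unfolding chen_XX[OF assms(1-4)] blinfun.add_right second_level_tensor[OF tens] x_def ..
  have sl: "blinfun_apply (second_level tens (Z' u) (M (y + a y) - M y)) (XX u t) =
      blinfun_apply (second_level tens (Z' u) (M (y + a y))) (XX u t)
      - blinfun_apply (second_level tens (Z' u) (M y)) (XX u t)"
    by (rule linear_diff[OF linear_second_level])
  have Mx: "blinfun_apply (M y) x = blinfun_apply (frechet_map F y) (blinfun_apply (F y) x)"
    by (simp add: M_def vector_field_derivative_def)
  have FZ: "blinfun_apply (F y) (Z t - Z s) =
      blinfun_apply (F y) (Z u - Z s) + blinfun_apply (F y) (Z t - Z u)"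
    by (simp add: blinfun.diff_right)
  have "germ_defect germ s u t y =
      blinfun_apply (F y) (Z t - Z s) + blinfun_apply (second_level tens (Z' s) (M y)) (XX s t)
      - (blinfun_apply (F y) (Z u - Z s) + blinfun_apply (second_level tens (Z' s) (M y)) (XX s u))
      - (blinfun_apply (F (y + a y)) (Z t - Z u)
          + blinfun_apply (second_level tens (Z' u) (M (y + a y))) (XX u t))"
    by (simp add: germ_defect_def germ_def M_def a_def)
  then show ?thesis
    unfolding XX sl FZ blinfun.diff_left blinfun.diff_right[of "frechet_map F y"]
      Mx
    by (simp add: blinfun.diff_right[of _ "blinfun_apply (Z' s) (X u t)"])
qed

text \<open>One summand for each of the five terms of \<open>germ_defect_decomposition\<close>, in
  the same order.\<close>

definition C2 :: real where
  "C2 = 2 * K ^ 3 * (5 * K\<^sup>2) + K\<^sup>2 * (K + K\<^sup>2) * (5 * K\<^sup>2) + K ^ 3 * (2 * (5 * K\<^sup>2 * C1))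
     + K * (2 * K * C1\<^sup>2) + K * (2 * (K * C3))"

lemma germ_defect_regular:
  assumes sut: "0 \<le> s" "s \<le> u" "u \<le> t" "t \<le> T"
  shows "bounded_lipschitz (C2 * (t - s) powr (3 * \<alpha>)) (germ_defect germ s u t)"
proof -
  define \<rho> where "\<rho> = (t - s) powr \<alpha>"
  have mono: "r powr \<alpha> \<le> \<rho>" if "0 \<le> r" "r \<le> t - s" for r
    unfolding \<rho>_def using that \<alpha> by (intro powr_mono2) auto
  have \<rho>0: "0 \<le> \<rho>" by (simp add: \<rho>_def)
  have su: "(u - s) powr \<alpha> \<le> \<rho>" and ut: "(t - u) powr \<alpha> \<le> \<rho>" using sut by (auto intro: mono)
  have sq: "k * (r powr \<alpha>)\<^sup>2 \<le> k * \<rho>\<^sup>2" if "r powr \<alpha> \<le> \<rho>" "0 \<le> k" for r k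
    using that by (intro mult_left_mono power_mono) auto
  have Xsu: "norm (X s u) \<le> K * \<rho>" using X_le[of s u] sut mult_left_mono[OF su K] by linarith
  have Xut: "norm (X u t) \<le> K * \<rho>" using X_le[of u t] sut mult_left_mono[OF ut K] by linarith
  have Zut: "norm (Z t - Z u) \<le> K * \<rho>" using Z_le[of u t] sut mult_left_mono[OF ut K] by linarith
  have XXut: "norm (XX u t) \<le> K * \<rho>\<^sup>2" using XX_le[of u t] sut sq[OF ut K] by linarith
  have RZ: "norm (Z t - Z u - blinfun_apply (Z' u) (X u t)) \<le> K * \<rho>\<^sup>2"
    using Z_remainder_le[of u t] sut sq[OF ut K] by linarith
  have dZ': "norm (Z' u - Z' s) \<le> K * \<rho>" using Z'_diff_le[of s u] sut mult_left_mono[OF su K] by linarith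
  have Zs: "norm (Z' s) \<le> K" and Zu: "norm (Z' u) \<le> K" using Z'_le sut by auto
  define M where "M = vector_field_derivative"
  note M_bl = vector_field_derivative_regular(1)[folded M_def]
  note M_fp = vector_field_derivative_regular(2)[folded M_def]
  define a where "a = germ s u"
  have a: "bounded_lipschitz (C1 * \<rho>) a"
    unfolding a_def using germ_regular(1)[of s u] mult_left_mono[OF su C13_nonneg(1)] sut
    by (auto intro: bounded_lipschitz_mono)
  define x where "x = blinfun_apply (Z' s) (X s u)"
  have x: "norm x \<le> K * (K * \<rho>)"
    unfolding x_def using norm_blinfun[of "Z' s" "X s u"] mult_mono[OF Zs Xsu] K by auto
  have b: "bounded_lipschitz (C3 * \<rho>\<^sup>2) (\<lambda>y. a y - blinfun_apply (F y) x)"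
    unfolding a_def x_def using germ_first_order[of s u] sq[OF su C13_nonneg(2)] sut
    by (auto intro: bounded_lipschitz_mono)
  define T1 where "T1 y = blinfun_apply (second_level tens (Z' s) (M y)) (XX u t)
        - blinfun_apply (second_level tens (Z' u) (M y)) (XX u t)" for y
  define T3 where "T3 y = blinfun_apply (blinfun_apply (M y) x) (blinfun_apply (Z' s) (X u t) - (Z t - Z u))" for y
  define T2 where "T2 y = blinfun_apply (second_level tens (Z' u) (M (y + a y) - M y)) (XX u t)" for y
  define T4 where "T4 y = blinfun_apply (F (y + a y) - F y - blinfun_apply (frechet_map F y) (a y)) (Z t - Z u)" for y
  define T5 where "T5 y = blinfun_apply (blinfun_apply (frechet_map F y) (a y - blinfun_apply (F y) x)) (Z t - Z u)" for y
  have "bounded_lipschitz ((2 * K ^ 3 * \<rho> ^ 3) * (5 * K\<^sup>2)) T1"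
    unfolding T1_def[abs_def]
  proof (rule bounded_lipschitz_linear[OF M_bl])
    show "linear (\<lambda>m :: 'u \<Rightarrow>\<^sub>L 'u \<Rightarrow>\<^sub>L 'w. blinfun_apply (second_level tens (Z' s) m) (XX u t)
        - blinfun_apply (second_level tens (Z' u) m) (XX u t))"
      by (rule linear_compose_sub[OF linear_second_level linear_second_level])
    fix m :: "'u \<Rightarrow>\<^sub>L 'u \<Rightarrow>\<^sub>L 'w"
    have "norm (blinfun_apply (second_level tens (Z' s) m - second_level tens (Z' u) m) (XX u t))
        \<le> norm (second_level tens (Z' s) m - second_level tens (Z' u) m) * norm (XX u t)"
      by (rule norm_blinfun)
    also have "\<dots> \<le> (norm m * norm (Z' s - Z' u) * (norm (Z' s) + norm (Z' u))) * norm (XX u t)"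
      by (intro mult_right_mono second_level_diff_bound[OF tens]) auto
    also have "\<dots> \<le> (norm m * (K * \<rho>) * (K + K)) * (K * \<rho>\<^sup>2)"
      using dZ' Zs Zu XXut K \<rho>0 by (intro mult_mono add_mono) (auto simp: norm_minus_commute)
    finally show "norm (blinfun_apply (second_level tens (Z' s) m) (XX u t)
        - blinfun_apply (second_level tens (Z' u) m) (XX u t)) \<le> (2 * K ^ 3 * \<rho> ^ 3) * norm m"
      by (simp add: blinfun.diff_left power2_eq_square power3_eq_cube algebra_simps)
  qed (use K \<rho>0 in simp)
  moreover have "bounded_lipschitz ((K\<^sup>2 * (K + K\<^sup>2) * \<rho> ^ 3) * (5 * K\<^sup>2)) T3"
    unfolding T3_def[abs_def]
  proof (rule bounded_lipschitz_linear[OF M_bl])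
    let ?z = "blinfun_apply (Z' s) (X u t) - (Z t - Z u)"
    show "linear (\<lambda>m :: 'u \<Rightarrow>\<^sub>L 'u \<Rightarrow>\<^sub>L 'w. blinfun_apply (blinfun_apply m x) ?z)"
      by (rule linearI) (simp_all add: blinfun.add_left blinfun.scaleR_left)
    \<comment> \<open>The remainder of \<open>Z\<close> on the interval from \<open>u\<close> to
      \<open>t\<close> is based at \<open>u\<close>, so \<open>Z' s\<close> is moved to
      \<open>Z' u\<close>, at a cost of order \<open>2 * \<alpha>\<close>.\<close>
    have "?z = - (Z t - Z u - blinfun_apply (Z' u) (X u t)) - blinfun_apply (Z' u - Z' s) (X u t)"
      by (simp add: blinfun.diff_left)
    then have "norm ?z \<le> norm (Z t - Z u - blinfun_apply (Z' u) (X u t)) + norm (blinfun_apply (Z' u - Z' s) (X u t))"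
      by (metis norm_minus_cancel norm_triangle_ineq4)
    also have "\<dots> \<le> K * \<rho>\<^sup>2 + (K * \<rho>) * (K * \<rho>)"
      using norm_blinfun[of "Z' u - Z' s" "X u t"] mult_mono[OF dZ' Xut] K \<rho>0
      by (intro add_mono RZ) auto
    finally have z: "norm ?z \<le> (K + K\<^sup>2) * \<rho>\<^sup>2" by (simp add: power2_eq_square algebra_simps)
    fix m :: "'u \<Rightarrow>\<^sub>L 'u \<Rightarrow>\<^sub>L 'w"
    have "norm (blinfun_apply (blinfun_apply m x) ?z) \<le> norm m * norm x * norm ?z"
      by (rule norm_blinfun2)
    also have "\<dots> \<le> norm m * (K * (K * \<rho>)) * ((K + K\<^sup>2) * \<rho>\<^sup>2)"
      using x z K \<rho>0 by (intro mult_mono) auto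
    finally show "norm (blinfun_apply (blinfun_apply m x) ?z) \<le> (K\<^sup>2 * (K + K\<^sup>2) * \<rho> ^ 3) * norm m"
      by (simp add: power2_eq_square power3_eq_cube algebra_simps)
  qed (use K \<rho>0 in simp)
  moreover have "bounded_lipschitz ((K\<^sup>2 * (K * \<rho>\<^sup>2)) * (2 * (5 * K\<^sup>2 * (C1 * \<rho>)))) T2"
    unfolding T2_def[abs_def] using K
    by (intro bounded_lipschitz_linear[OF bounded_lipschitz_shift[OF M_fp a] linear_second_level
          second_level_le[OF Zu XXut]]) auto
  moreover have "bounded_lipschitz ((K * \<rho>) * (2 * K * (C1 * \<rho>)\<^sup>2)) T4"
    unfolding T4_def[abs_def] using K \<rho>0
    by (intro bounded_lipschitz_linear[OF bounded_lipschitz_taylor[OF F_derivative D_bl D_fp a]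
          linear_eval eval_le[OF Zut]]) auto
  moreover have "bounded_lipschitz ((K * \<rho>) * (2 * (K * (C3 * \<rho>\<^sup>2)))) T5"
    unfolding T5_def[abs_def] using K \<rho>0
    by (intro bounded_lipschitz_linear[OF bounded_lipschitz_prod[OF bounded_bilinear_blinfun_apply
          norm_blinfun D_bl b] linear_eval eval_le[OF Zut]]) auto
  ultimately have "bounded_lipschitz ((2 * K ^ 3 * \<rho> ^ 3) * (5 * K\<^sup>2) + (K\<^sup>2 * (K + K\<^sup>2) * \<rho> ^ 3) * (5 * K\<^sup>2)
      + (K\<^sup>2 * (K * \<rho>\<^sup>2)) * (2 * (5 * K\<^sup>2 * (C1 * \<rho>))) + (K * \<rho>) * (2 * K * (C1 * \<rho>)\<^sup>2)
      + (K * \<rho>) * (2 * (K * (C3 * \<rho>\<^sup>2)))) (\<lambda>y. T1 y + T3 y - T2 y - T4 y - T5 y)"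
    by (intro bounded_lipschitz_add bounded_lipschitz_diff)
  moreover have "(\<lambda>y. T1 y + T3 y - T2 y - T4 y - T5 y) = germ_defect germ s u t"
    unfolding T1_def T2_def T3_def T4_def T5_def M_def a_def x_def
      germ_defect_decomposition[OF sut, abs_def] ..
  moreover have "(2 * K ^ 3 * \<rho> ^ 3) * (5 * K\<^sup>2) + (K\<^sup>2 * (K + K\<^sup>2) * \<rho> ^ 3) * (5 * K\<^sup>2)
      + (K\<^sup>2 * (K * \<rho>\<^sup>2)) * (2 * (5 * K\<^sup>2 * (C1 * \<rho>))) + (K * \<rho>) * (2 * K * (C1 * \<rho>)\<^sup>2)
      + (K * \<rho>) * (2 * (K * (C3 * \<rho>\<^sup>2))) = C2 * \<rho> ^ 3"
    unfolding C2_def by (simp add: power2_eq_square power3_eq_cube algebra_simps)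
  ultimately show ?thesis by (simp only: \<rho>_def powr_multiples)
qed

lemma C2_nonneg: "0 \<le> C2"
  using K C13_nonneg by (simp add: C2_def)

lemma germ_diagonal: "0 \<le> s \<Longrightarrow> s \<le> T \<Longrightarrow> germ s s y = 0"
  using XX_le[of s s] \<alpha> by (simp add: germ_def)

lemma davie_germ_germ: "davie_germ germ T (C1 + C2) \<alpha> (3 * \<alpha>)"
proof
  note nn = C13_nonneg C2_nonneg
  show "0 < \<alpha>" "1 < 3 * \<alpha>" "0 \<le> C1 + C2" using \<alpha> nn by auto
  show "germ s s y = 0" if "0 \<le> s" "s \<le> T" for s y using germ_diagonal that .
  fix s t and y z r q :: 'w
  assume st: "0 \<le> s" "s \<le> t" "t \<le> T"
  show "norm ((germ s t (y + r) - germ s t y) - (germ s t (z + q) - germ s t z))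
      \<le> (C1 + C2) * (t - s) powr \<alpha> * (norm (r - q) + norm q * norm (y - z))"
    by (rule four_point_boundedD[OF four_point_bounded_mono[OF germ_regular(2)[OF st]]])
      (use nn in \<open>auto intro: mult_right_mono\<close>)
next
  fix s u t and y z :: 'w
  assume st: "0 \<le> s" "s \<le> u" "u \<le> t" "t \<le> T"
  have "bounded_lipschitz ((C1 + C2) * (t - s) powr (3 * \<alpha>)) (germ_defect germ s u t)"
    by (rule bounded_lipschitz_mono[OF germ_defect_regular[OF st]])
      (use C13_nonneg in \<open>auto intro: mult_right_mono\<close>)
  then show "norm (germ_defect germ s u t y) \<le> (C1 + C2) * (t - s) powr (3 * \<alpha>)"
    "norm (germ_defect germ s u t y - germ_defect germ s u t z)
      \<le> (C1 + C2) * (t - s) powr (3 * \<alpha>) * norm (y - z)"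
    by (auto dest: bounded_lipschitzD)
qed

end

section \<open>Rough integrals and solutions\<close>

lemma eventually_partition_filter:
  "eventually P (partition_filter s t) \<longleftrightarrow>
    (\<exists>\<delta>>0. \<forall>ps. is_partition s t ps \<and> (\<forall>(u, v)\<in>set (partition_intervals ps). v - u < \<delta>) \<longrightarrow> P ps)"
proof -
  define S where "S \<delta> = {ps. is_partition s t ps \<and> (\<forall>(u, v)\<in>set (partition_intervals ps). v - u < \<delta>)}"
    for \<delta> :: real
  have "eventually P (INF \<delta>\<in>{0<..}. principal (S \<delta>)) \<longleftrightarrow>
      (\<exists>\<delta>\<in>{0<..}. eventually P (principal (S \<delta>)))"
  proof (rule eventually_INF_base)
    fix a b :: real
    assume "a \<in> {0<..}" "b \<in> {0<..}"
    then show "\<exists>x\<in>{0<..}. principal (S x) \<le> inf (principal (S a)) (principal (S b))"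
      by (intro bexI[of _ "min a b"]) (auto simp: S_def)
  qed auto
  then show ?thesis
    by (auto simp: partition_filter_def S_def eventually_principal)
qed

lemma partition_intervals_Cons2: "partition_intervals (x # y # zs) = (x, y) # partition_intervals (y # zs)"
  by (simp add: partition_intervals_def)

lemma partition_with_small_mesh_ex:
  assumes "s \<le> t" "0 < \<delta>"
  shows "\<exists>ps. is_partition s t ps \<and> (\<forall>(u, v)\<in>set (partition_intervals ps). v - u < \<delta>)"
proof -
  \<comment> \<open>Steps of length \<open>\<delta> / 2\<close>, because the mesh has to be strictly
    below \<delta>.\<close>
  obtain n :: nat where "(t - s) / (\<delta> / 2) \<le> real n" using real_arch_simple by blast
  then have "t - s \<le> real n * (\<delta> / 2)" using assms by (simp add: field_simps)
  then show ?thesis using assms(1)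
  proof (induction n arbitrary: s)
    case 0
    then show ?case by (intro exI[of _ "[s]"]) (auto simp: is_partition_def partition_intervals_def)
  next
    case (Suc n)
    show ?case
    proof (cases "s + \<delta> / 2 \<le> t")
      case True
      then obtain ps where ps: "is_partition (s + \<delta> / 2) t ps"
        "\<forall>(u, v)\<in>set (partition_intervals ps). v - u < \<delta>"
        using Suc.IH[of "s + \<delta> / 2"] Suc.prems by (auto simp: algebra_simps)
      then obtain qs where qs: "ps = (s + \<delta> / 2) # qs"
        by (cases ps) (auto simp: is_partition_def)
      have "is_partition s t (s # ps)"
        using ps(1) assms(2) unfolding qs by (auto simp: is_partition_def)
      then show ?thesis using ps(2) assms(2) unfolding qs
        by (intro exI[of _ "s # (s + \<delta> / 2) # qs"]) (auto simp: partition_intervals_Cons2)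
    next
      case False
      show ?thesis
      proof (cases "s = t")
        case True
        then show ?thesis by (intro exI[of _ "[s]"]) (auto simp: is_partition_def partition_intervals_def)
      next
        case False
        then show ?thesis using \<open>\<not> s + \<delta> / 2 \<le> t\<close> Suc.prems assms(2)
          by (intro exI[of _ "[s, t]"]) (auto simp: is_partition_def partition_intervals_def)
      qed
    qed
  qed
qed

text \<open>Along a trivial filter every point is a limit and \<open>Lim\<close> would be
  meaningless.\<close>

lemma partition_filter_neq_bot:
  assumes "s \<le> t"
  shows "partition_filter s t \<noteq> bot"
  using partition_with_small_mesh_ex[OF assms]
  unfolding trivial_limit_def eventually_partition_filter by blast

lemma partition_head_le_last:
  "is_partition s t ps \<Longrightarrow> s \<le> t"
  by (cases ps) (auto simp: is_partition_def intro: less_imp_le[OF bspec[OF _ last_in_set]])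

lemma partition_interval_mem:
  assumes "is_partition s t ps" "(u, v) \<in> set (partition_intervals ps)"
  shows "s \<le> u \<and> u < v \<and> v \<le> t"
  using assms
proof (induction ps arbitrary: s rule: induct_list012)
  case (3 x y zs)
  have p: "is_partition y t (y # zs)" and xy: "s = x" "x < y" using 3(3) by (auto simp: is_partition_def)
  have "y \<le> t" using partition_head_le_last[OF p] .
  moreover have "(u, v) = (x, y) \<or> (u, v) \<in> set (partition_intervals (y # zs))"
    using 3(4) by (simp add: partition_intervals_Cons2)
  ultimately show ?case using 3(2)[OF p] xy by force
qed (auto simp: is_partition_def partition_intervals_def)

lemma partition_sum_error:
  fixes I :: "real \<Rightarrow> 'b::real_normed_vector"
  assumes part: "is_partition s t ps"
    and err: "\<And>u v. \<lbrakk>s \<le> u; u < v; v \<le> t; v - u < \<delta>\<rbrakk> \<Longrightarrow> norm (I v - I u - \<Xi> u v) \<le> e * (v - u)"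
    and mesh: "\<forall>(u, v)\<in>set (partition_intervals ps). v - u < \<delta>"
  shows "norm (I t - I s - (\<Sum>(u, v)\<leftarrow>partition_intervals ps. \<Xi> u v)) \<le> e * (t - s)"
  using assms
proof (induction ps arbitrary: s rule: induct_list012)
  case (3 x y zs)
  have p: "is_partition y t (y # zs)" and xy: "s = x" "x < y" using 3(3) by (auto simp: is_partition_def)
  have yt: "y \<le> t" using partition_head_le_last[OF p] .
  have 1: "norm (I t - I y - (\<Sum>(u, v)\<leftarrow>partition_intervals (y # zs). \<Xi> u v)) \<le> e * (t - y)"
    using 3(4,5) xy by (intro 3(2)[OF p]) (auto simp: partition_intervals_Cons2)
  have 2: "norm (I y - I x - \<Xi> x y) \<le> e * (y - x)"
    using 3(5) xy yt by (intro 3(4)) (auto simp: partition_intervals_Cons2)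
  have eq: "I t - I s - (\<Sum>(u, v)\<leftarrow>partition_intervals (x # y # zs). \<Xi> u v)
      = (I t - I y - (\<Sum>(u, v)\<leftarrow>partition_intervals (y # zs). \<Xi> u v)) + (I y - I x - \<Xi> x y)"
    by (simp add: partition_intervals_Cons2 xy)
  show ?case unfolding eq using norm_triangle_mono[OF 1 2] by (simp add: xy algebra_simps)
qed (auto simp: is_partition_def partition_intervals_def)

text \<open>Since \<theta> > 1, an error of order \<theta> is an arbitrarily small multiple of the
  length of a short interval, and errors proportional to the length add up to at most a multiple of
  \<open>t - s\<close>.\<close>

lemma partition_sums_tendsto:
  fixes I :: "real \<Rightarrow> 'b::real_normed_vector"
  assumes "s \<le> t" "1 < \<theta>" "0 \<le> C"
    and err: "\<And>u v. \<lbrakk>s \<le> u; u \<le> v; v \<le> t\<rbrakk> \<Longrightarrow> norm (I v - I u - \<Xi> u v) \<le> C * (v - u) powr \<theta>"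
  shows "((\<lambda>ps. \<Sum>(u, v)\<leftarrow>partition_intervals ps. \<Xi> u v) \<longlongrightarrow> I t - I s) (partition_filter s t)"
proof (rule tendstoI)
  fix e :: real assume e: "0 < e"
  \<comment> \<open>The added 1 covers \<open>s = t\<close> and gives a strict inequality.\<close>
  define e' where "e' = e / (t - s + 1)"
  have e': "0 < e'" "e' * (t - s) < e" using e assms by (auto simp: e'_def field_simps)
  obtain \<delta> where \<delta>: "0 < \<delta>" "\<And>x. 0 \<le> x \<Longrightarrow> x \<le> \<delta> \<Longrightarrow> C * x powr (\<theta> - 1) \<le> e'"
    by (rule small_powr_ex[of C e' "\<theta> - 1"]) (use assms e' in auto)
  have "norm (I v - I u - \<Xi> u v) \<le> e' * (v - u)" if "s \<le> u" "u < v" "v \<le> t" "v - u < \<delta>" for u v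
  proof -
    have "norm (I v - I u - \<Xi> u v) \<le> C * (v - u) powr \<theta>" using err that by simp
    also have "(v - u) powr \<theta> = (v - u) powr (\<theta> - 1) * (v - u)"
      using that by (simp flip: powr_mult_base add: powr_diff)
    also have "C * ((v - u) powr (\<theta> - 1) * (v - u)) \<le> e' * (v - u)"
      unfolding mult.assoc[symmetric] using that \<delta>(2) by (intro mult_right_mono) auto
    finally show ?thesis .
  qed
  then have "norm (I t - I s - (\<Sum>(u, v)\<leftarrow>partition_intervals ps. \<Xi> u v)) < e"
    if "is_partition s t ps" "\<forall>(u, v)\<in>set (partition_intervals ps). v - u < \<delta>" for ps
    using partition_sum_error[OF that(1) _ that(2), of I \<Xi> e'] e'(2) by fastforce
  then show "\<forall>\<^sub>F ps in partition_filter s t. dist (\<Sum>(u, v)\<leftarrow>partition_intervals ps. \<Xi> u v) (I t - I s) < e"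
    unfolding eventually_partition_filter using \<delta>(1)
    by (intro exI[of _ \<delta>]) (auto simp: dist_norm norm_minus_commute)
qed

lemma holder_boundedD:
  assumes "holder_bounded \<beta> T A"
  obtains C where "0 \<le> C" "\<And>s t. \<lbrakk>0 \<le> s; s < t; t \<le> T\<rbrakk> \<Longrightarrow> norm (A s t) \<le> C * (t - s) powr \<beta>"
proof -
  obtain M where M: "\<And>s t. \<lbrakk>0 \<le> s; s < t; t \<le> T\<rbrakk> \<Longrightarrow> norm (A s t) / \<bar>t - s\<bar> powr \<beta> \<le> M"
    using assms unfolding holder_bounded_def bdd_above_def by blast
  show ?thesis
  proof (rule that[of "max 0 M"])
    fix s t assume st: "0 \<le> s" "s < t" "t \<le> T"
    then have "norm (A s t) / (t - s) powr \<beta> \<le> max 0 M" using M[OF st] by auto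
    then show "norm (A s t) \<le> max 0 M * (t - s) powr \<beta>" using st by (simp add: divide_le_eq)
  qed auto
qed

lemma holder_boundedI:
  assumes "\<And>s t. \<lbrakk>0 \<le> s; s < t; t \<le> T\<rbrakk> \<Longrightarrow> norm (A s t) \<le> C * (t - s) powr \<beta>"
  shows "holder_bounded \<beta> T A"
  unfolding holder_bounded_def bdd_above_def
  using assms by (intro exI[of _ C]) (auto simp: divide_le_eq)

section \<open>Solutions of the equation are the Davie paths of its germ\<close>

context rough_equation
begin

abbreviation solution :: "'w \<Rightarrow> (real \<Rightarrow> 'w) \<Rightarrow> (real \<Rightarrow> 'v \<Rightarrow>\<^sub>L 'w) \<Rightarrow> bool" where
  "solution y0 Y Y' \<equiv> rde_solution tens \<alpha> T X XX Z Z' F y0 Y Y'"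

lemma rough_sum_eq_germ_sum:
  assumes part: "is_partition 0 t ps" and "t \<le> T"
    and Y': "\<And>r. \<lbrakk>0 \<le> r; r \<le> T\<rbrakk> \<Longrightarrow> Y' r = F (Y r) o\<^sub>L Z' r"
  shows "rough_sum tens XX (\<lambda>r. F (Y r)) (\<lambda>r. frechet_map F (Y r) o\<^sub>L Y' r) Z Z' ps
    = (\<Sum>(u, v)\<leftarrow>partition_intervals ps. germ u v (Y u))"
  unfolding rough_sum_def
proof (intro arg_cong[where f = sum_list] map_cong refl)
  fix uv assume "uv \<in> set (partition_intervals ps)"
  then have "0 \<le> fst uv" "fst uv \<le> T"
    using partition_interval_mem[OF part, of "fst uv" "snd uv"] \<open>t \<le> T\<close> by auto
  then show "(case uv of (u, v) \<Rightarrow> blinfun_apply (F (Y u)) (Z v - Z u) +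
        blinfun_apply (tensor_extension tens (\<lambda>x y. blinfun_apply
          (blinfun_apply (frechet_map F (Y u) o\<^sub>L Y' u) x) (blinfun_apply (Z' u) y))) (XX u v))
      = (case uv of (u, v) \<Rightarrow> germ u v (Y u))"
    by (cases uv) (simp add: germ_def second_level_def vector_field_derivative_def Y')
qed

lemma rough_integral_eq:
  assumes t: "0 \<le> t" "t \<le> T" and C: "0 \<le> C"
    and Y': "\<And>r. \<lbrakk>0 \<le> r; r \<le> T\<rbrakk> \<Longrightarrow> Y' r = F (Y r) o\<^sub>L Z' r"
    and err: "\<And>u v. \<lbrakk>0 \<le> u; u \<le> v; v \<le> T\<rbrakk> \<Longrightarrow>
      norm (I v - I u - germ u v (Y u)) \<le> C * (v - u) powr (3 * \<alpha>)"
  shows "rough_integral tens XX (\<lambda>r. F (Y r)) (\<lambda>r. frechet_map F (Y r) o\<^sub>L Y' r) Z Z' 0 t = I t - I 0"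
  unfolding rough_integral_def
proof (rule tendsto_Lim[OF partition_filter_neq_bot[OF t(1)]])
  have "\<forall>\<^sub>F ps in partition_filter 0 t. (\<Sum>(u, v)\<leftarrow>partition_intervals ps. germ u v (Y u))
      = rough_sum tens XX (\<lambda>r. F (Y r)) (\<lambda>r. frechet_map F (Y r) o\<^sub>L Y' r) Z Z' ps"
    unfolding eventually_partition_filter
    using rough_sum_eq_germ_sum[where Y = Y and Y' = Y', OF _ t(2) Y']
    by (intro exI[of _ 1]) (auto simp del: o_apply)
  moreover have "((\<lambda>ps. \<Sum>(u, v)\<leftarrow>partition_intervals ps. germ u v (Y u)) \<longlongrightarrow> I t - I 0) (partition_filter 0 t)"
    using \<alpha> t C err by (intro partition_sums_tendsto[where \<theta> = "3 * \<alpha>" and C = C]) auto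
  ultimately show "((\<lambda>ps. rough_sum tens XX (\<lambda>r. F (Y r)) (\<lambda>r. frechet_map F (Y r) o\<^sub>L Y' r) Z Z' ps)
      \<longlongrightarrow> I t - I 0) (partition_filter 0 t)"
    by (rule Lim_transform_eventually[rotated])
qed

text \<open>The germ agrees with \<open>F(Y) Z' X\<close> up to order \<open>2 * \<alpha>\<close>,
  and the deviation from the germ is of higher order, its surplus being absorbed in
  \<open>T powr \<alpha>\<close>.\<close>

lemma davie_path_controlled:
  assumes Y: "davie_path germ (3 * \<alpha>) L 0 T Y" and L: "0 \<le> L"
  shows "controlled_path \<alpha> T X Y (\<lambda>r. F (Y r) o\<^sub>L Z' r)"
  unfolding controlled_path_def
proof
  have dev: "norm (Y t - Y s - germ s t (Y s)) \<le> L * T powr \<alpha> * ((t - s) powr \<alpha>)\<^sup>2"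
    if st: "0 \<le> s" "s \<le> t" "t \<le> T" for s t
  proof -
    have "norm (Y t - Y s - germ s t (Y s)) \<le> L * ((t - s) powr \<alpha> * ((t - s) powr \<alpha>)\<^sup>2)"
      using davie_pathD[OF Y st] by (simp add: deviation_def powr_multiples power3_eq_cube power2_eq_square)
    also have "\<dots> \<le> L * (T powr \<alpha> * ((t - s) powr \<alpha>)\<^sup>2)"
      using L powr_le_T[OF st] by (intro mult_left_mono mult_right_mono) auto
    finally show ?thesis by (simp add: mult.assoc)
  qed
  have Y_holder: "norm (Y t - Y s) \<le> (L * T powr \<alpha> * T powr \<alpha> + C1) * (t - s) powr \<alpha>"
    if st: "0 \<le> s" "s \<le> t" "t \<le> T" for s t
  proof -
    have "norm (Y t - Y s) \<le> norm (Y t - Y s - germ s t (Y s)) + norm (germ s t (Y s))"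
      by norm
    also have "\<dots> \<le> L * T powr \<alpha> * ((t - s) powr \<alpha>)\<^sup>2 + C1 * (t - s) powr \<alpha>"
      using dev[OF st] bounded_lipschitzD(1)[OF germ_regular(1)[OF st]] by (intro add_mono) auto
    also have "L * T powr \<alpha> * ((t - s) powr \<alpha>)\<^sup>2 \<le> L * T powr \<alpha> * (T powr \<alpha> * (t - s) powr \<alpha>)"
      unfolding power2_eq_square using L powr_le_T[OF st] by (intro mult_left_mono mult_right_mono) auto
    finally show ?thesis by (simp add: algebra_simps)
  qed
  show "holder_bounded (2 * \<alpha>) T (\<lambda>s t. Y t - Y s - blinfun_apply (F (Y s) o\<^sub>L Z' s) (X s t))"
  proof (rule holder_boundedI)
    fix s t assume "0 \<le> s" "s < t" "t \<le> T"
    then have st: "0 \<le> s" "s \<le> t" "t \<le> T" by auto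
    have "norm (Y t - Y s - blinfun_apply (F (Y s) o\<^sub>L Z' s) (X s t))
      \<le> norm (Y t - Y s - germ s t (Y s))
        + norm (germ s t (Y s) - blinfun_apply (F (Y s)) (blinfun_apply (Z' s) (X s t)))"
      using norm_triangle_ineq[of "Y t - Y s - germ s t (Y s)"
          "germ s t (Y s) - blinfun_apply (F (Y s)) (blinfun_apply (Z' s) (X s t))"] by simp
    also have "\<dots> \<le> L * T powr \<alpha> * ((t - s) powr \<alpha>)\<^sup>2 + C3 * ((t - s) powr \<alpha>)\<^sup>2"
      using dev[OF st] bounded_lipschitzD(1)[OF germ_first_order[OF st]] by (intro add_mono) auto
    finally show "norm (Y t - Y s - blinfun_apply (F (Y s) o\<^sub>L Z' s) (X s t))
        \<le> (L * T powr \<alpha> + C3) * (t - s) powr (2 * \<alpha>)"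
      by (simp add: powr_multiples distrib_right)
  qed
  show "holder_bounded \<alpha> T (\<lambda>s t. (F (Y t) o\<^sub>L Z' t) - (F (Y s) o\<^sub>L Z' s))"
  proof (rule holder_boundedI)
    fix s t assume "0 \<le> s" "s < t" "t \<le> T"
    then have st: "0 \<le> s" "s \<le> t" "t \<le> T" by auto
    have "(F (Y t) o\<^sub>L Z' t) - (F (Y s) o\<^sub>L Z' s)
        = ((F (Y t) - F (Y s)) o\<^sub>L Z' t) + (F (Y s) o\<^sub>L (Z' t - Z' s))"
      by (rule blinfun_eqI) (simp add: blinfun.bilinear_simps)
    then have "norm ((F (Y t) o\<^sub>L Z' t) - (F (Y s) o\<^sub>L Z' s))
        \<le> norm (F (Y t) - F (Y s)) * norm (Z' t) + norm (F (Y s)) * norm (Z' t - Z' s)"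
      by (simp add: norm_triangle_mono norm_blinfun_compose)
    also have "\<dots> \<le> (K * ((L * T powr \<alpha> * T powr \<alpha> + C1) * (t - s) powr \<alpha>)) * K + K * (K * (t - s) powr \<alpha>)"
    proof (intro add_mono mult_mono)
      have "norm (F (Y t) - F (Y s)) \<le> K * norm (Y t - Y s)" by (rule bounded_lipschitzD[OF F_bl])
      also have "\<dots> \<le> K * ((L * T powr \<alpha> * T powr \<alpha> + C1) * (t - s) powr \<alpha>)"
        using Y_holder[OF st] K by (rule mult_left_mono)
      finally show "norm (F (Y t) - F (Y s)) \<le> K * ((L * T powr \<alpha> * T powr \<alpha> + C1) * (t - s) powr \<alpha>)" .
    qed (use K Z'_le Z'_diff_le st bounded_lipschitzD(1)[OF F_bl] L C13_nonneg in auto)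
    finally show "norm ((F (Y t) o\<^sub>L Z' t) - (F (Y s) o\<^sub>L Z' s))
        \<le> (K * (L * T powr \<alpha> * T powr \<alpha> + C1) * K + K * K) * (t - s) powr \<alpha>"
      by (simp add: algebra_simps)
  qed
qed

lemma davie_path_solution:
  assumes Y: "davie_path germ (3 * \<alpha>) L 0 T Y" and L: "0 \<le> L"
  shows "solution (Y 0) Y (\<lambda>r. F (Y r) o\<^sub>L Z' r)"
proof -
  have "rough_integral tens XX (\<lambda>r. F (Y r)) (\<lambda>r. frechet_map F (Y r) o\<^sub>L (F (Y r) o\<^sub>L Z' r)) Z Z' 0 t
      = Y t - Y 0" if "t \<in> {0..T}" for t
    using that by (intro rough_integral_eq[OF _ _ L]) (use davie_pathD[OF Y] in \<open>auto simp: deviation_def\<close>)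
  then show ?thesis using davie_path_controlled[OF Y L] by (simp add: rde_solution_def)
qed

text \<open>For a given solution the germ is frozen along it, \<open>\<Xi> s t = germ s t (Y s)\<close>. Sewing this germ,
  which does not depend on the state, shows that the compensated Riemann sums converge, so the
  limit in the definition of the rough integral is not a junk value.\<close>

lemma solution_davie_path:
  assumes sol: "solution y0 Y Y'"
  shows "Y 0 = y0 \<and> (\<exists>L. davie_path germ (3 * \<alpha>) L 0 T Y)"
proof -
  have Y': "Y' r = F (Y r) o\<^sub>L Z' r" if "0 \<le> r" "r \<le> T" for r
    using sol that by (simp add: rde_solution_def)
  obtain N where N: "0 \<le> N" and rem: "\<And>s t. \<lbrakk>0 \<le> s; s < t; t \<le> T\<rbrakk> \<Longrightarrow>
      norm (Y t - Y s - blinfun_apply (Y' s) (X s t)) \<le> N * (t - s) powr (2 * \<alpha>)"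
  proof -
    have "holder_bounded (2 * \<alpha>) T (\<lambda>s t. Y t - Y s - blinfun_apply (Y' s) (X s t))"
      using sol by (simp add: rde_solution_def controlled_path_def)
    from holder_boundedD[OF this] show thesis using that by blast
  qed
  \<comment> \<open>The predicted and the true state share the first-order term
    \<open>F(Y s) (Z' s (X s u))\<close>, by the prescribed form of \<open>Y'\<close>, so they
    differ at order \<open>2 * \<alpha>\<close> only.\<close>
  have close: "norm (Y s + germ s u (Y s) - Y u) \<le> (C3 + N) * ((u - s) powr \<alpha>)\<^sup>2"
    if su: "0 \<le> s" "s \<le> u" "u \<le> T" for s u
  proof (cases "s = u")
    case True
    then show ?thesis using su germ_diagonal by simp
  next
    case False
    have "norm (Y s + germ s u (Y s) - Y u)
        \<le> norm (germ s u (Y s) - blinfun_apply (F (Y s)) (blinfun_apply (Z' s) (X s u)))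
          + norm (Y u - Y s - blinfun_apply (Y' s) (X s u))"
      using norm_triangle_ineq4[of "germ s u (Y s) - blinfun_apply (F (Y s)) (blinfun_apply (Z' s) (X s u))"
          "Y u - Y s - blinfun_apply (Y' s) (X s u)"] su Y' by (simp add: algebra_simps)
    also have "\<dots> \<le> C3 * ((u - s) powr \<alpha>)\<^sup>2 + N * ((u - s) powr \<alpha>)\<^sup>2"
      using bounded_lipschitzD(1)[OF germ_first_order[OF su]] rem[of s u] su False
      by (intro add_mono) (auto simp: powr_multiples)
    finally show ?thesis by (simp add: distrib_right)
  qed
  define \<Xi> where "\<Xi> = (\<lambda>s t (_ :: 'w). germ s t (Y s))"
  define C where "C = C2 + C1 * (C3 + N)"
  have "davie_germ \<Xi> T C \<alpha> (3 * \<alpha>)"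
  proof
    show "0 < \<alpha>" "1 < 3 * \<alpha>" "0 \<le> C" using \<alpha> N C13_nonneg C2_nonneg by (auto simp: C_def)
    then show "norm ((\<Xi> s t (y + r) - \<Xi> s t y) - (\<Xi> s t (z + q) - \<Xi> s t z))
        \<le> C * (t - s) powr \<alpha> * (norm (r - q) + norm q * norm (y - z))" for s t y z r q
      by (simp add: \<Xi>_def)
    show "\<Xi> s s y = 0" if "0 \<le> s" "s \<le> T" for s y using germ_diagonal that by (simp add: \<Xi>_def)
    fix s u t and y z :: 'w
    assume sut: "0 \<le> s" "s \<le> u" "u \<le> t" "t \<le> T"
    then have ut: "0 \<le> u" "u \<le> t" "t \<le> T" and su: "0 \<le> s" "s \<le> u" "u \<le> T" by auto
    show "norm (germ_defect \<Xi> s u t y - germ_defect \<Xi> s u t z) \<le> C * (t - s) powr (3 * \<alpha>) * norm (y - z)"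
      using \<open>0 \<le> C\<close> by (simp add: \<Xi>_def germ_defect_def)
    define \<rho> where "\<rho> = (t - s) powr \<alpha>"
    have \<rho>: "(u - s) powr \<alpha> \<le> \<rho>" "(t - u) powr \<alpha> \<le> \<rho>"
      unfolding \<rho>_def using sut \<alpha> by (auto intro!: powr_mono2)
    have "germ_defect \<Xi> s u t y = germ_defect germ s u t (Y s)
        + (germ u t (Y s + germ s u (Y s)) - germ u t (Y u))"
      by (simp add: \<Xi>_def germ_defect_def)
    then have "norm (germ_defect \<Xi> s u t y) \<le> norm (germ_defect germ s u t (Y s))
        + norm (germ u t (Y s + germ s u (Y s)) - germ u t (Y u))"
      by (simp add: norm_triangle_ineq)
    also have "\<dots> \<le> C2 * \<rho> ^ 3 + (C1 * \<rho>) * ((C3 + N) * \<rho>\<^sup>2)"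
    proof (rule add_mono)
      show "norm (germ_defect germ s u t (Y s)) \<le> C2 * \<rho> ^ 3"
        using bounded_lipschitzD(1)[OF germ_defect_regular[OF sut]] by (simp add: \<rho>_def powr_multiples)
      have "norm (germ u t (Y s + germ s u (Y s)) - germ u t (Y u))
          \<le> (C1 * (t - u) powr \<alpha>) * norm (Y s + germ s u (Y s) - Y u)"
        by (rule bounded_lipschitzD[OF germ_regular(1)[OF ut]])
      also have "\<dots> \<le> (C1 * \<rho>) * ((C3 + N) * \<rho>\<^sup>2)"
      proof (intro mult_mono)
        have "(C3 + N) * ((u - s) powr \<alpha>)\<^sup>2 \<le> (C3 + N) * \<rho>\<^sup>2"
          using \<rho> N C13_nonneg by (intro mult_left_mono power_mono) auto
        then show "norm (Y s + germ s u (Y s) - Y u) \<le> (C3 + N) * \<rho>\<^sup>2"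
          using close[OF su] by simp
      qed (use \<rho> C13_nonneg in \<open>auto simp: \<rho>_def\<close>)
      finally show "norm (germ u t (Y s + germ s u (Y s)) - germ u t (Y u))
          \<le> (C1 * \<rho>) * ((C3 + N) * \<rho>\<^sup>2)" .
    qed
    also have "\<dots> = C * (t - s) powr (3 * \<alpha>)"
      unfolding C_def \<rho>_def powr_multiples
      by (simp add: power2_eq_square power3_eq_cube algebra_simps)
    finally show "norm (germ_defect \<Xi> s u t y) \<le> C * (t - s) powr (3 * \<alpha>)" .
  qed
  \<comment> \<open>The starting value is arbitrary; only increments of \<open>I\<close> are
    used.\<close>
  from davie_germ.global_existence[OF this less_imp_le[OF T], of 0]
  obtain I L where L: "0 \<le> L" and I: "davie_path \<Xi> (3 * \<alpha>) L 0 T I" by blast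
  have int: "rough_integral tens XX (\<lambda>r. F (Y r)) (\<lambda>r. frechet_map F (Y r) o\<^sub>L Y' r) Z Z' 0 t = I t - I 0"
    if "t \<in> {0..T}" for t
    using that davie_pathD[OF I] Y'
    by (intro rough_integral_eq[OF _ _ L]) (auto simp: deviation_def \<Xi>_def)
  have Y: "Y t = y0 + (I t - I 0)" if "t \<in> {0..T}" for t
    using sol that int[OF that] by (simp add: rde_solution_def)
  \<comment> \<open>\<open>Y\<close> and \<open>I\<close> have the same increments, and \<Xi> is
    \<open>germ\<close> along \<open>Y\<close>; so Davie's estimate for \<open>I\<close> is the one
    for \<open>Y\<close>.\<close>
  have "davie_path germ (3 * \<alpha>) L 0 T Y"
    unfolding davie_path_def
  proof (intro allI impI)
    fix s t assume st: "0 \<le> s \<and> s \<le> t \<and> t \<le> T"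
    then have "deviation germ Y s t = deviation \<Xi> I s t"
      using Y[of s] Y[of t] by (simp add: deviation_def \<Xi>_def)
    then show "norm (deviation germ Y s t) \<le> L * (t - s) powr (3 * \<alpha>)"
      using davie_pathD[OF I] st by simp
  qed
  then show ?thesis using Y[of 0] T by auto
qed

theorem solution_unique_ex:
  "\<exists>Y Y'. solution y0 Y Y' \<and>
     (\<forall>Y2 Y2'. solution y0 Y2 Y2' \<longrightarrow> (\<forall>t\<in>{0..T}. Y2 t = Y t \<and> Y2' t = Y' t))"
proof -
  interpret davie_germ germ T "C1 + C2" \<alpha> "3 * \<alpha>" by (rule davie_germ_germ)
  obtain Y L where Y0: "Y 0 = y0" and L: "0 \<le> L" and Y: "davie_path germ (3 * \<alpha>) L 0 T Y"
    using global_existence T by (metis less_imp_le)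
  show ?thesis
  proof (intro exI[of _ Y] exI[of _ "\<lambda>r. F (Y r) o\<^sub>L Z' r"] conjI allI impI ballI)
    show "solution y0 Y (\<lambda>r. F (Y r) o\<^sub>L Z' r)" using davie_path_solution[OF Y L] Y0 by simp
    fix Y2 Y2' t
    assume sol: "solution y0 Y2 Y2'" and t: "t \<in> {0..T}"
    from solution_davie_path[OF sol] obtain M where
      "Y2 0 = y0" "davie_path germ (3 * \<alpha>) M 0 T Y2" by auto
    then show eq: "Y2 t = Y t" using uniqueness[OF _ Y] Y0 t by auto
    show "Y2' t = F (Y t) o\<^sub>L Z' t" using sol t eq by (simp add: rde_solution_def)
  qed
qed

end

section \<open>Uniform constants from the Hoelder hypotheses\<close>

lemma rough_equation_ex:
  fixes tens :: "'v::banach \<Rightarrow> 'v \<Rightarrow> 'vv::banach"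
    and Z :: "real \<Rightarrow> 'u::banach" and F :: "'w::banach \<Rightarrow> 'u \<Rightarrow>\<^sub>L 'w"
  assumes tens: "projective_tensor tens" and \<alpha>: "1 / 3 < \<alpha>" and T: "0 < T"
    and rough: "rough_path tens \<alpha> T X XX" and Z: "controlled_path \<alpha> T X Z Z'" and F: "C3b F"
  shows "\<exists>K. rough_equation tens \<alpha> T X XX Z Z' F K"
proof -
  have chen: "X s t = X s u + X u t" "XX s t = XX s u + XX u t + tens (X s u) (X u t)"
    if "0 \<le> s" "s \<le> u" "u \<le> t" "t \<le> T" for s u t
    using rough that by (auto simp: rough_path_def)
  have tens0: "tens 0 0 = 0"
    using tens bilinear_lzero by (auto simp: projective_tensor_def)
  \<comment> \<open>The Hoelder conditions speak of \<open>s < t\<close> only; on the diagonal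
    Chen's relation forces both levels to vanish.\<close>
  have diag: "X s s = 0" "XX s s = 0" if "0 \<le> s" "s \<le> T" for s
  proof -
    show X0: "X s s = 0" using chen(1)[of s s s] that by simp
    show "XX s s = 0" using chen(2)[of s s s] that by (simp add: X0 tens0)
  qed
  have hX: "holder_bounded \<alpha> T X" and hXX: "holder_bounded (2 * \<alpha>) T XX"
    using rough by (auto simp: rough_path_def)
  have hZ: "holder_bounded (2 * \<alpha>) T (\<lambda>s t. Z t - Z s - blinfun_apply (Z' s) (X s t))"
    and hZ': "holder_bounded \<alpha> T (\<lambda>s t. Z' t - Z' s)"
    using Z by (auto simp: controlled_path_def)
  from holder_boundedD[OF hX] obtain k1 where k1: "0 \<le> k1"
    "\<And>s t. \<lbrakk>0 \<le> s; s < t; t \<le> T\<rbrakk> \<Longrightarrow> norm (X s t) \<le> k1 * (t - s) powr \<alpha>" by blast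
  from holder_boundedD[OF hXX] obtain k2 where k2: "0 \<le> k2"
    "\<And>s t. \<lbrakk>0 \<le> s; s < t; t \<le> T\<rbrakk> \<Longrightarrow> norm (XX s t) \<le> k2 * (t - s) powr (2 * \<alpha>)" by blast
  from holder_boundedD[OF hZ] obtain k3 where k3: "0 \<le> k3" "\<And>s t. \<lbrakk>0 \<le> s; s < t; t \<le> T\<rbrakk> \<Longrightarrow>
      norm (Z t - Z s - blinfun_apply (Z' s) (X s t)) \<le> k3 * (t - s) powr (2 * \<alpha>)" by blast
  from holder_boundedD[OF hZ'] obtain k4 where k4: "0 \<le> k4"
    "\<And>s t. \<lbrakk>0 \<le> s; s < t; t \<le> T\<rbrakk> \<Longrightarrow> norm (Z' t - Z' s) \<le> k4 * (t - s) powr \<alpha>" by blast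
  obtain c where c: "\<And>x. (F has_derivative blinfun_apply (frechet_map F x)) (at x)"
    "bounded_lipschitz c F" "four_point_bounded c F"
    "bounded_lipschitz c (frechet_map F)" "four_point_bounded c (frechet_map F)"
    using C3b_bounds[OF F] by blast
  have X: "norm (X s t) \<le> k1 * (t - s) powr \<alpha>" if "0 \<le> s" "s \<le> t" "t \<le> T" for s t
    using k1(2)[of s t] diag that by (cases "s = t") auto
  have XX: "norm (XX s t) \<le> k2 * ((t - s) powr \<alpha>)\<^sup>2" if "0 \<le> s" "s \<le> t" "t \<le> T" for s t
    using k2(2)[of s t] diag that by (cases "s = t") (auto simp: powr_multiples)
  have ZR: "norm (Z t - Z s - blinfun_apply (Z' s) (X s t)) \<le> k3 * ((t - s) powr \<alpha>)\<^sup>2"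
    if "0 \<le> s" "s \<le> t" "t \<le> T" for s t
    using k3(2)[of s t] diag that by (cases "s = t") (auto simp: powr_multiples blinfun.zero_right)
  have dZ': "norm (Z' t - Z' s) \<le> k4 * (t - s) powr \<alpha>" if "0 \<le> s" "s \<le> t" "t \<le> T" for s t
    using k4(2)[of s t] that by (cases "s = t") auto
  have le_T: "(t - s) powr \<alpha> \<le> T powr \<alpha>" if "0 \<le> s" "s \<le> t" "t \<le> T" for s t
    using that \<alpha> by (intro powr_mono2) auto
  define k5 where "k5 = norm (Z' 0) + k4 * T powr \<alpha>"
  have Z': "norm (Z' s) \<le> k5" if "0 \<le> s" "s \<le> T" for s
  proof -
    have "norm (Z' s) \<le> norm (Z' 0) + norm (Z' s - Z' 0)" by norm
    also have "norm (Z' s - Z' 0) \<le> k4 * T powr \<alpha>"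
      using dZ'[of 0 s] mult_left_mono[OF le_T[of 0 s] k4(1)] that by simp
    finally show ?thesis by (simp add: k5_def)
  qed
  have k5: "0 \<le> k5" using k4 by (simp add: k5_def)
  \<comment> \<open>\<open>Z\<close> is controlled by \<open>X\<close>, hence Hoelder of order
    \<alpha>: the remainder gives the first summand, \<open>Z' s\<close> applied to
    \<open>X s t\<close> the second.\<close>
  define k6 where "k6 = k3 * T powr \<alpha> + k5 * k1"
  have dZ: "norm (Z t - Z s) \<le> k6 * (t - s) powr \<alpha>" if st: "0 \<le> s" "s \<le> t" "t \<le> T" for s t
  proof -
    have "norm (Z t - Z s) \<le> norm (Z t - Z s - blinfun_apply (Z' s) (X s t)) + norm (blinfun_apply (Z' s) (X s t))"
      by norm
    also have "\<dots> \<le> k3 * ((t - s) powr \<alpha> * (t - s) powr \<alpha>) + k5 * (k1 * (t - s) powr \<alpha>)"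
      using ZR[OF st] norm_blinfun[of "Z' s" "X s t"] mult_mono[OF Z'[of s] X[OF st] k5] st
      by (intro add_mono) (auto simp: power2_eq_square)
    also have "k3 * ((t - s) powr \<alpha> * (t - s) powr \<alpha>) \<le> k3 * (T powr \<alpha> * (t - s) powr \<alpha>)"
      using k3(1) le_T[OF st] by (intro mult_left_mono mult_right_mono) auto
    finally show ?thesis by (simp add: k6_def algebra_simps)
  qed
  define K where "K = Max {0, k1, k2, k3, k4, k5, k6, c}"
  have K: "0 \<le> K" "k1 \<le> K" "k2 \<le> K" "k3 \<le> K" "k4 \<le> K" "k5 \<le> K" "k6 \<le> K" "c \<le> K"
    unfolding K_def by (intro Max_ge; simp)+
  have "rough_equation tens \<alpha> T X XX Z Z' F K"
  proof
    show "norm (X s t) \<le> K * (t - s) powr \<alpha>" if "0 \<le> s" "s \<le> t" "t \<le> T" for s t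
      using X[OF that] mult_right_mono[OF K(2), of "(t - s) powr \<alpha>"] by simp
    show "norm (XX s t) \<le> K * ((t - s) powr \<alpha>)\<^sup>2" if "0 \<le> s" "s \<le> t" "t \<le> T" for s t
      using XX[OF that] mult_right_mono[OF K(3), of "((t - s) powr \<alpha>)\<^sup>2"] by simp
    show "norm (Z t - Z s) \<le> K * (t - s) powr \<alpha>" if "0 \<le> s" "s \<le> t" "t \<le> T" for s t
      using dZ[OF that] mult_right_mono[OF K(7), of "(t - s) powr \<alpha>"] by simp
    show "norm (Z t - Z s - blinfun_apply (Z' s) (X s t)) \<le> K * ((t - s) powr \<alpha>)\<^sup>2"
      if "0 \<le> s" "s \<le> t" "t \<le> T" for s t
      using ZR[OF that] mult_right_mono[OF K(4), of "((t - s) powr \<alpha>)\<^sup>2"] by simp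
    show "norm (Z' s) \<le> K" if "0 \<le> s" "s \<le> T" for s using Z'[OF that] K by simp
    show "norm (Z' t - Z' s) \<le> K * (t - s) powr \<alpha>" if "0 \<le> s" "s \<le> t" "t \<le> T" for s t
      using dZ'[OF that] mult_right_mono[OF K(5), of "(t - s) powr \<alpha>"] by simp
  qed (use assms chen K c bounded_lipschitz_mono four_point_bounded_mono in \<open>blast+\<close>)
  then show ?thesis ..
qed

theorem theorem3p10:
  fixes tens :: "'v::banach \<Rightarrow> 'v \<Rightarrow> 'vv::banach"
    and \<alpha> T :: real
    and X :: "real \<Rightarrow> real \<Rightarrow> 'v"
    and XX :: "real \<Rightarrow> real \<Rightarrow> 'vv"
    and Z :: "real \<Rightarrow> 'u::banach"
    and Z' :: "real \<Rightarrow> 'v \<Rightarrow>\<^sub>L 'u"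
    and F :: "'w::banach \<Rightarrow> 'u \<Rightarrow>\<^sub>L 'w"
    and y0 :: 'w
  assumes "projective_tensor tens"
    and "1 / 3 < \<alpha>" and "\<alpha> \<le> 1 / 2" and "0 < T"
    and "rough_path tens \<alpha> T X XX"
    and "controlled_path \<alpha> T X Z Z'"
    and "C3b F"
  shows "\<exists>Y Y'. rde_solution tens \<alpha> T X XX Z Z' F y0 Y Y' \<and>
           (\<forall>Y2 Y2'. rde_solution tens \<alpha> T X XX Z Z' F y0 Y2 Y2' \<longrightarrow>
              (\<forall>t\<in>{0..T}. Y2 t = Y t \<and> Y2' t = Y' t))"
proof -
  obtain K where "rough_equation tens \<alpha> T X XX Z Z' F K"
    using rough_equation_ex[OF assms(1,2,4-7)] by blast
  then show ?thesis by (rule rough_equation.solution_unique_ex)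
qed

end
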